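(* For each $k\in\{1,2,4,5\}$ (i.e. lengths $3k\in\{3,6,12,15\}$), there is, up to equivalence, exactly one binary linear $3$-CIS $[3k,k]$ code whose minimum distance is the largest possible among all $3$-CIS $[3k,k]$ codes. For $k=3$, the largest possible minimum distance of a $3$-CIS $[9,3]$ code is $4$, and there are exactly eight pairwise inequivalent $3$-CIS $[9,3,4]$ codes.
   Context: A binary linear $[tk,k]$ code is $t$-CIS if its coordinate set can be partitioned into $t$ pairwise disjoint information sets, where an information set of a linear $[n,k]$ code is a set of $k$ coordinates such that the corresponding $k$ columns of a generator matrix are linearly independent. Two codes are equivalent if one is obtained from the other by a permutation of coordinates. *)

theory Defs
  imports Main
begin

text \<open>Binary vectors of length n are represented by their supports, i.e. subsets of
  {..<n}; vector addition over GF(2) is symmetric difference and the Hamming weight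
  is the cardinality. A k x n binary matrix G is represented by its rows
  G i (i < k), each given by its support.\<close>

definition row_comb :: "(nat \<Rightarrow> nat set) \<Rightarrow> nat set \<Rightarrow> nat set" where
  "row_comb G S = {j. odd (card {i\<in>S. j \<in> G i})}"

definition generator_matrix :: "nat \<Rightarrow> nat \<Rightarrow> (nat \<Rightarrow> nat set) \<Rightarrow> nat set set \<Rightarrow> bool" where
  "generator_matrix n k G C \<longleftrightarrow>
     (\<forall>i<k. G i \<subseteq> {..<n}) \<and>
     (\<forall>S\<subseteq>{..<k}. S \<noteq> {} \<longrightarrow> row_comb G S \<noteq> {}) \<and>
     C = {row_comb G S | S. S \<subseteq> {..<k}}"

definition binary_linear_code :: "nat \<Rightarrow> nat \<Rightarrow> nat set set \<Rightarrow> bool" where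
  "binary_linear_code n k C \<longleftrightarrow> (\<exists>G. generator_matrix n k G C)"

definition columns_independent :: "nat \<Rightarrow> (nat \<Rightarrow> nat set) \<Rightarrow> nat set \<Rightarrow> bool" where
  "columns_independent k G J \<longleftrightarrow>
     (\<forall>J'\<subseteq>J. J' \<noteq> {} \<longrightarrow> (\<exists>i<k. odd (card {j\<in>J'. j \<in> G i})))"

definition information_set :: "nat \<Rightarrow> nat \<Rightarrow> nat set set \<Rightarrow> nat set \<Rightarrow> bool" where
  "information_set n k C I \<longleftrightarrow>
     I \<subseteq> {..<n} \<and> card I = k \<and>
     (\<exists>G. generator_matrix n k G C \<and> columns_independent k G I)"

definition CIS :: "nat \<Rightarrow> nat \<Rightarrow> nat set set \<Rightarrow> bool" where
  "CIS t k C \<longleftrightarrow> binary_linear_code (t * k) k C \<and>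
     (\<exists>P :: nat \<Rightarrow> nat set.
        (\<forall>i<t. information_set (t * k) k C (P i)) \<and>
        (\<forall>i<t. \<forall>j<t. i \<noteq> j \<longrightarrow> P i \<inter> P j = {}) \<and>
        (\<Union>i<t. P i) = {..<t * k})"

definition min_dist :: "nat set set \<Rightarrow> nat" where
  "min_dist C = Min (card ` (C - {{}}))"

definition code_equiv :: "nat \<Rightarrow> nat set set \<Rightarrow> nat set set \<Rightarrow> bool" where
  "code_equiv n C D \<longleftrightarrow> (\<exists>\<sigma>. bij_betw \<sigma> {..<n} {..<n} \<and> D = (\<lambda>c. \<sigma> ` c) ` C)"

end

theory Submission
  imports Defs
begin

text \<open>
  A code is determined up to equivalence by the multiplicities of the columns of any of its
  generator matrices, so uniqueness amounts to choosing a basis of the code for which all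
  multiplicities are forced.

  Averaging the weights of the nonzero words bounds the minimum distance by 3, 4, 5, 6, 7 for
  \<open>k = 1, \<dots>, 5\<close>, with a parity argument improving 5 to 4. For \<open>k = 4\<close> a repeated column would make
  the words vanishing there too light; hence all weights are 6, 7 or 8, and the second moment gives
  \<open>\<Sum>(w - 6)(8 - w) \<le> 0\<close>, so there are exactly three words of weight 8. With two of them as rows, the
  three missing columns are the nonzero ones vanishing in both rows. For \<open>k = 5\<close> the extension by a
  parity bit has all weights between 8 and 16, and \<open>\<Sum>(w - 8)(16 - w) \<le> 0\<close> forces the columns to be
  distinct and the all-one word to occur; with that word and four even words as rows, exactly one
  column is missing, and it is found by parity.

  For \<open>k = 3\<close>, information sets contain no repeated columns, so multiplicities are at most 3, and a
  basis whose weights are lexicographically maximal leaves eight multiplicity vectors.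
\<close>

section \<open>Row combinations and changes of basis\<close>

lemma row_comb_empty [simp]: "row_comb G {} = {}"
  by (simp add: row_comb_def)

lemma row_comb_insert:
  assumes "finite S" "i \<notin> S"
  shows "row_comb G (insert i S) = sym_diff (G i) (row_comb G S)"
proof -
  have "{x \<in> insert i S. j \<in> G x} = (if j \<in> G i then insert i {x \<in> S. j \<in> G x} else {x \<in> S. j \<in> G x})" for j
    by auto
  then show ?thesis
    using assms by (auto simp: row_comb_def)
qed

lemma row_comb_singleton [simp]: "row_comb G {i} = G i"
  using row_comb_insert[of "{}" i G] by simp

lemma row_comb_cong: "(\<And>i. i \<in> S \<Longrightarrow> G i = H i) \<Longrightarrow> row_comb G S = row_comb H S"
  unfolding row_comb_def by (metis (mono_tags, lifting) Collect_cong)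

lemma row_comb_subset:
  assumes "finite S" "\<And>i. i \<in> S \<Longrightarrow> G i \<subseteq> A"
  shows "row_comb G S \<subseteq> A"
  using assms by (induction S) (auto simp: row_comb_insert)

lemma odd_card_sym_diff:
  assumes "finite A" "finite B"
  shows "odd (card (sym_diff A B)) \<longleftrightarrow> odd (card A) \<noteq> odd (card B)"
proof -
  have "card (sym_diff A B) = card (A - B) + card (B - A)"
    using assms by (intro card_Un_disjoint) auto
  moreover have "card A = card (A - B) + card (A \<inter> B)" "card B = card (B - A) + card (A \<inter> B)"
    using assms by (metis Diff_disjoint Int_Diff_Un Int_Diff_disjoint Int_commute add.commute card_Un_disjoint finite_Diff finite_Int)+
  ultimately show ?thesis by presburger
qed

lemma odd_card_Int_sym_diff:
  assumes "finite S"
  shows "odd (card (S \<inter> sym_diff p q)) \<longleftrightarrow> odd (card (S \<inter> p)) \<noteq> odd (card (S \<inter> q))"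
proof -
  have "S \<inter> sym_diff p q = sym_diff (S \<inter> p) (S \<inter> q)" by auto
  then show ?thesis using odd_card_sym_diff[of "S \<inter> p" "S \<inter> q"] assms by simp
qed

lemma row_comb_sym_diff:
  assumes "finite S" "finite T"
  shows "row_comb G (sym_diff S T) = sym_diff (row_comb G S) (row_comb G T)"
proof -
  have "odd (card {i \<in> sym_diff S T. j \<in> G i}) \<longleftrightarrow>
      odd (card {i \<in> S. j \<in> G i}) \<noteq> odd (card {i \<in> T. j \<in> G i})" for j
  proof -
    have "{i \<in> sym_diff S T. j \<in> G i} = sym_diff {i \<in> S. j \<in> G i} {i \<in> T. j \<in> G i}" by auto
    then show ?thesis
      using odd_card_sym_diff[of "{i \<in> S. j \<in> G i}" "{i \<in> T. j \<in> G i}"] assms by simp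
  qed
  then show ?thesis unfolding row_comb_def by blast
qed

text \<open>Over GF(2), \<open>row_comb\<close> is a product of a coefficient vector with a matrix,
  and this is associativity of that product. It turns a change of basis into a computation with
  coefficient sets.\<close>

lemma row_comb_row_comb:
  assumes "finite T" "\<And>i. i \<in> T \<Longrightarrow> finite (P i)"
  shows "row_comb (\<lambda>i. row_comb G (P i)) T = row_comb G (row_comb P T)"
  using assms
proof (induction T)
  case (insert i T)
  have "finite (row_comb P T)"
    using row_comb_subset[of T P "\<Union>(P ` T)"] insert by (meson UN_upper finite_UN_I finite_subset insertI2)
  with insert show ?case by (simp add: row_comb_insert row_comb_sym_diff)
qed simp

section \<open>Linear independence over GF(2) and extension of partial bases\<close>

definition independent :: "nat \<Rightarrow> (nat \<Rightarrow> nat set) \<Rightarrow> bool" where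
  "independent m P \<longleftrightarrow> (\<forall>S\<subseteq>{..<m}. S \<noteq> {} \<longrightarrow> row_comb P S \<noteq> {})"

lemma independent_inj_on:
  assumes "independent m P"
  shows "inj_on (row_comb P) (Pow {..<m})"
proof (rule inj_onI)
  fix S T assume *: "S \<in> Pow {..<m}" "T \<in> Pow {..<m}" "row_comb P S = row_comb P T"
  then have "finite S" "finite T" by (auto intro: finite_subset)
  with * have "row_comb P (sym_diff S T) = {}" by (simp add: row_comb_sym_diff)
  moreover have "sym_diff S T \<subseteq> {..<m}" using * by auto
  ultimately have "sym_diff S T = {}" using assms unfolding independent_def by blast
  then show "S = T" by auto
qed

lemma independent_card_span:
  assumes "independent m P"
  shows "card (row_comb P ` Pow {..<m}) = 2 ^ m"
  using card_image[OF independent_inj_on[OF assms]] by (simp add: card_Pow)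

lemma independent_upd:
  assumes "independent m P" "u \<notin> row_comb P ` Pow {..<m}"
  shows "independent (Suc m) (P(m := u))"
  unfolding independent_def
proof (intro allI impI)
  fix S assume S: "S \<subseteq> {..<Suc m}" "S \<noteq> {}"
  define T where "T = S - {m}"
  have T: "T \<subseteq> {..<m}" "finite T" using S by (auto simp: T_def intro: finite_subset)
  have eq: "row_comb (P(m := u)) T = row_comb P T"
    by (rule row_comb_cong) (auto simp: T_def)
  show "row_comb (P(m := u)) S \<noteq> {}"
  proof (cases "m \<in> S")
    case True
    then have "S = insert m T" by (auto simp: T_def)
    then have "row_comb (P(m := u)) S = sym_diff u (row_comb P T)"
      using row_comb_insert[OF T(2), of m "P(m := u)"] eq by (simp add: T_def)
    moreover have "u \<noteq> row_comb P T" using assms(2) T by auto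
    ultimately show ?thesis by auto
  next
    case False
    then have "S = T" by (auto simp: T_def)
    then show ?thesis using assms(1) S(2) T(1) eq by (simp add: independent_def)
  qed
qed

text \<open>Fewer than \<open>m\<close> independent vectors span fewer than \<open>2 ^ m\<close>
  vectors, so a set \<open>U\<close> of that size always offers a vector outside the span. As
  \<open>U\<close> may be any set, the new vectors can be asked to have a prescribed weight or
  parity.\<close>

lemma independent_extend:
  assumes "independent l P" "l \<le> m" "card U \<ge> 2 ^ m"
  shows "\<exists>Q. independent m Q \<and> (\<forall>i<l. Q i = P i) \<and> (\<forall>i. l \<le> i \<and> i < m \<longrightarrow> Q i \<in> U)"
  using assms(2,3)
proof (induction m rule: dec_induct)
  case base
  then show ?case using assms(1) by auto
next
  case (step m)
  have "2 ^ m \<le> card U"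
    by (rule order_trans[OF _ step.prems]) simp
  then obtain Q where Q: "independent m Q" "\<forall>i<l. Q i = P i" "\<forall>i. l \<le> i \<and> i < m \<longrightarrow> Q i \<in> U"
    using step.IH by blast
  have "\<not> U \<subseteq> row_comb Q ` Pow {..<m}"
  proof
    assume "U \<subseteq> row_comb Q ` Pow {..<m}"
    then have "card U \<le> 2 ^ m"
      using card_mono[of "row_comb Q ` Pow {..<m}" U] independent_card_span[OF Q(1)] by simp
    moreover have "(2::nat) ^ m < 2 ^ Suc m" by simp
    ultimately show False using step.prems by linarith
  qed
  then obtain u where u: "u \<in> U" "u \<notin> row_comb Q ` Pow {..<m}" by blast
  have "independent (Suc m) (Q(m := u))" by (rule independent_upd[OF Q(1) u(2)])
  moreover have "\<forall>i<l. (Q(m := u)) i = P i" using Q(2) step.hyps by auto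
  moreover have "\<forall>i. l \<le> i \<and> i < Suc m \<longrightarrow> (Q(m := u)) i \<in> U" using Q(3) u(1) by auto
  ultimately show ?case by blast
qed

section \<open>Change of basis of a generator matrix\<close>

lemma generator_matrix_independent: "generator_matrix n k G C \<Longrightarrow> independent k G"
  by (simp add: generator_matrix_def independent_def)

lemma generator_matrix_change_basis:
  assumes G: "generator_matrix n k G C"
    and P: "\<And>i. i < k \<Longrightarrow> P i \<subseteq> {..<k}" "independent k P"
  shows "generator_matrix n k (\<lambda>i. row_comb G (P i)) C"
proof -
  have fin: "finite (P i)" if "i < k" for i using P(1)[OF that] by (rule finite_subset) simp
  have sub: "row_comb P S \<subseteq> {..<k}" if "S \<subseteq> {..<k}" for S
    using that P(1) by (intro row_comb_subset) (auto intro: finite_subset)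
  have comp: "row_comb (\<lambda>i. row_comb G (P i)) S = row_comb G (row_comb P S)" if "S \<subseteq> {..<k}" for S
    using that fin by (intro row_comb_row_comb) (auto intro: finite_subset)
  \<comment> \<open>Independence makes the \<open>2 ^ k\<close> combinations distinct, so they
    exhaust the subsets of \<open>{..<k}\<close>; hence the new rows span the whole code.\<close>
  have surj: "row_comb P ` Pow {..<k} = Pow {..<k}"
    using sub independent_card_span[OF P(2)] by (intro card_subset_eq) (auto simp: card_Pow)
  have "row_comb G (P i) \<subseteq> {..<n}" if "i < k" for i
    using G P(1)[OF that] fin[OF that] unfolding generator_matrix_def
    by (intro row_comb_subset) auto
  moreover have "row_comb (\<lambda>i. row_comb G (P i)) S \<noteq> {}" if "S \<subseteq> {..<k}" "S \<noteq> {}" for S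
  proof -
    have "row_comb P S \<noteq> {}" using P(2) that by (simp add: independent_def)
    then show ?thesis using G sub[OF that(1)] by (simp add: generator_matrix_def comp[OF that(1)])
  qed
  moreover have "C = {row_comb (\<lambda>i. row_comb G (P i)) S | S. S \<subseteq> {..<k}}"
  proof -
    have "C = row_comb G ` Pow {..<k}" using G by (auto simp: generator_matrix_def)
    also have "\<dots> = row_comb G ` row_comb P ` Pow {..<k}" by (simp add: surj)
    also have "\<dots> = (\<lambda>S. row_comb (\<lambda>i. row_comb G (P i)) S) ` Pow {..<k}"
      unfolding image_image by (intro image_cong) (auto simp: comp)
    finally show ?thesis by auto
  qed
  ultimately show ?thesis by (simp add: generator_matrix_def)
qed

lemma generator_matrix_code: "generator_matrix n k G C \<Longrightarrow> C = row_comb G ` Pow {..<k}"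
  by (auto simp: generator_matrix_def)

lemma generator_matrix_word_subset:
  assumes "generator_matrix n k G C" "S \<subseteq> {..<k}"
  shows "row_comb G S \<subseteq> {..<n}"
  using assms unfolding generator_matrix_def by (intro row_comb_subset) (auto intro: finite_subset)

section \<open>Columns and their multiplicities\<close>

definition col :: "nat \<Rightarrow> (nat \<Rightarrow> nat set) \<Rightarrow> nat \<Rightarrow> nat set" where
  "col k G j = {i. i < k \<and> j \<in> G i}"

definition mult :: "nat \<Rightarrow> nat \<Rightarrow> (nat \<Rightarrow> nat set) \<Rightarrow> nat set \<Rightarrow> nat" where
  "mult n k G p = card {j. j < n \<and> col k G j = p}"

lemma col_subset: "col k G j \<subseteq> {..<k}"
  by (auto simp: col_def)

lemma row_comb_iff_col:
  assumes "S \<subseteq> {..<k}"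
  shows "j \<in> row_comb G S \<longleftrightarrow> odd (card (S \<inter> col k G j))"
proof -
  have "{i \<in> S. j \<in> G i} = S \<inter> col k G j" using assms by (auto simp: col_def)
  then show ?thesis by (simp add: row_comb_def)
qed

text \<open>The right-hand side mentions only the code, so the coincidence of two columns does not
  depend on the chosen basis.\<close>

lemma col_eq_iff:
  assumes "generator_matrix n k G C"
  shows "col k G i = col k G j \<longleftrightarrow> (\<forall>c\<in>C. i \<in> c \<longleftrightarrow> j \<in> c)"
proof
  assume "col k G i = col k G j"
  then show "\<forall>c\<in>C. i \<in> c \<longleftrightarrow> j \<in> c"
    using generator_matrix_code[OF assms] by (auto simp: row_comb_iff_col)
next
  assume *: "\<forall>c\<in>C. i \<in> c \<longleftrightarrow> j \<in> c"
  have "G l \<in> C" if "l < k" for l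
    using generator_matrix_code[OF assms] that row_comb_singleton[of G l]
    by (metis (no_types, lifting) Pow_iff empty_subsetI image_eqI insert_subset lessThan_iff)
  with * show "col k G i = col k G j" by (auto simp: col_def)
qed

lemma col_empty_iff:
  assumes "generator_matrix n k G C"
  shows "col k G j = {} \<longleftrightarrow> (\<forall>c\<in>C. j \<notin> c)"
proof
  assume "col k G j = {}"
  then show "\<forall>c\<in>C. j \<notin> c"
    using generator_matrix_code[OF assms] by (auto simp: row_comb_iff_col)
next
  assume *: "\<forall>c\<in>C. j \<notin> c"
  have "G l \<in> C" if "l < k" for l
    using generator_matrix_code[OF assms] that row_comb_singleton[of G l]
    by (metis (no_types, lifting) Pow_iff empty_subsetI image_eqI insert_subset lessThan_iff)
  with * show "col k G j = {}" by (auto simp: col_def)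
qed

text \<open>Whether a coordinate lies in the word with coefficient set \<open>S\<close> depends only
  on its column. Any permutation matching equal columns therefore maps each word of \<open>C\<close>
  to the word of \<open>D\<close> with the same coefficients.\<close>

lemma code_equiv_if_mult_eq:
  assumes G: "generator_matrix n k G C" and H: "generator_matrix n k H D"
    and eq: "\<And>p. p \<subseteq> {..<k} \<Longrightarrow> mult n k G p = mult n k H p"
  shows "code_equiv n C D"
proof -
  define F where "F M p = {j. j < n \<and> col k M j = p}" for M p
  have finF: "finite (F M p)" for M p by (simp add: F_def)
  have "\<exists>f. bij_betw f (F G p) (F H p)" if "p \<subseteq> {..<k}" for p
    using eq[OF that] finF by (intro finite_same_card_bij) (auto simp: mult_def F_def)
  then obtain f where f: "\<And>p. p \<subseteq> {..<k} \<Longrightarrow> bij_betw (f p) (F G p) (F H p)" by metis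
  \<comment> \<open>The bijections between the classes of coordinates with equal column are glued
    into one permutation.\<close>
  define \<sigma> where "\<sigma> j = f (col k G j) j" for j
  have \<sigma>: "\<sigma> j < n \<and> col k H (\<sigma> j) = col k G j" if "j < n" for j
  proof -
    have "j \<in> F G (col k G j)" using that by (simp add: F_def)
    then have "\<sigma> j \<in> F H (col k G j)"
      unfolding \<sigma>_def using f[OF col_subset] by (meson bij_betwE)
    then show ?thesis by (simp add: F_def)
  qed
  have "inj_on \<sigma> {..<n}"
  proof (rule inj_onI)
    fix i j assume ij: "i \<in> {..<n}" "j \<in> {..<n}" "\<sigma> i = \<sigma> j"
    then have *: "col k G i = col k G j" using \<sigma> by (metis lessThan_iff)
    then have "i \<in> F G (col k G i)" "j \<in> F G (col k G i)" using ij by (auto simp: F_def)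
    moreover have "f (col k G i) i = f (col k G i) j" using ij(3) * by (simp add: \<sigma>_def)
    ultimately show "i = j" using f[OF col_subset] by (metis bij_betw_imp_inj_on inj_onD)
  qed
  moreover have "\<sigma> ` {..<n} \<subseteq> {..<n}" using \<sigma> by auto
  ultimately have bij: "bij_betw \<sigma> {..<n} {..<n}"
    by (simp add: bij_betw_def endo_inj_surj)
  have img: "\<sigma> ` row_comb G S = row_comb H S" if S: "S \<subseteq> {..<k}" for S
  proof
    show "\<sigma> ` row_comb G S \<subseteq> row_comb H S"
    proof
      fix x assume "x \<in> \<sigma> ` row_comb G S"
      then obtain j where j: "j \<in> row_comb G S" "x = \<sigma> j" by auto
      then have "j < n" using generator_matrix_word_subset[OF G S] by auto
      with j \<sigma>[of j] show "x \<in> row_comb H S" by (simp add: row_comb_iff_col[OF S])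
    qed
    show "row_comb H S \<subseteq> \<sigma> ` row_comb G S"
    proof
      fix x assume x: "x \<in> row_comb H S"
      then have "x \<in> \<sigma> ` {..<n}"
        using generator_matrix_word_subset[OF H S] bij by (auto simp: bij_betw_def)
      then obtain j where "j < n" "x = \<sigma> j" by auto
      with x \<sigma>[of j] show "x \<in> \<sigma> ` row_comb G S" by (auto simp: row_comb_iff_col[OF S])
    qed
  qed
  have "D = (\<lambda>c. \<sigma> ` c) ` C"
    unfolding generator_matrix_code[OF G] generator_matrix_code[OF H] image_image
    by (intro image_cong) (auto simp: img)
  with bij show ?thesis unfolding code_equiv_def by blast
qed

section \<open>Weight moments\<close>

text \<open>The inner product of \<open>S\<close> and \<open>p\<close> over GF(2), read as the
  integer 0 or 1 so that it can be summed and subtracted.\<close>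

definition chi :: "nat set \<Rightarrow> nat set \<Rightarrow> int" where
  "chi S p = of_bool (odd (card (S \<inter> p)))"

lemma chi_cases: "chi S p = 0 \<or> chi S p = 1"
  by (simp add: chi_def)

lemma chi_empty [simp]: "chi {} p = 0" "chi S {} = 0"
  by (simp_all add: chi_def)

text \<open>For bits, 2xy = x + y - (x xor y). This linearizes products, so that second moments
  reduce to sums of single values of \<open>chi\<close>.\<close>

lemma chi_mult_chi:
  assumes "finite S"
  shows "2 * (chi S p * chi S q) = chi S p + chi S q - chi S (sym_diff p q)"
  using odd_card_Int_sym_diff[OF assms, of p q] by (auto simp: chi_def)

text \<open>For a fixed \<open>a\<close> in \<open>p\<close>, adding \<open>a\<close> to
  \<open>S\<close> flips the parity; the subsets of \<open>A\<close> thus fall into pairs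
  contributing 1 each.\<close>

lemma sum_chi_Pow:
  assumes "finite A" "p \<subseteq> A"
  shows "(\<Sum>S\<in>Pow A. chi S p) = (if p = {} then 0 else 2 ^ (card A - 1))"
proof (cases "p = {}")
  case False
  then obtain a where a: "a \<in> p" by auto
  define B where "B = A - {a}"
  have B: "finite B" "a \<notin> B" "A = insert a B" using assms a by (auto simp: B_def)
  have inj: "inj_on (insert a) (Pow B)" using B(2) by (auto simp: inj_on_def)
  have "chi S p + chi (insert a S) p = 1" if "S \<in> Pow B" for S
  proof -
    have "insert a S \<inter> p = insert a (S \<inter> p)" "a \<notin> S \<inter> p" "finite (S \<inter> p)"
      using a B that by (auto intro: finite_subset)
    then show ?thesis by (simp add: chi_def)
  qed
  then have "(\<Sum>S\<in>Pow B. chi S p + chi (insert a S) p) = 2 ^ card B"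
    using B(1) by (simp add: card_Pow)
  moreover have "(\<Sum>S\<in>Pow A. chi S p) = (\<Sum>S\<in>Pow B. chi S p) + (\<Sum>S\<in>insert a ` Pow B. chi S p)"
    unfolding B(3) Pow_insert using B by (intro sum.union_disjoint) auto
  moreover have "(\<Sum>S\<in>insert a ` Pow B. chi S p) = (\<Sum>S\<in>Pow B. chi (insert a S) p)"
    using sum.reindex[OF inj] by (simp add: o_def)
  ultimately have "(\<Sum>S\<in>Pow A. chi S p) = 2 ^ card B" by (simp add: sum.distrib)
  moreover have "card A - 1 = card B" using B by simp
  ultimately show ?thesis using False by simp
qed simp

text \<open>The columns are an arbitrary family because the code extended by a parity bit is needed too.\<close>

definition wt :: "nat \<Rightarrow> (nat \<Rightarrow> nat set) \<Rightarrow> nat set \<Rightarrow> int" where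
  "wt n c S = (\<Sum>j<n. chi S (c j))"

lemma wt_empty [simp]: "wt n c {} = 0"
  by (simp add: wt_def)

text \<open>First moment, by exchanging the sums: each nonzero column is met oddly by half of all
  coefficient sets.\<close>

lemma sum_wt:
  assumes "\<And>j. j < n \<Longrightarrow> c j \<subseteq> {..<k}" "\<And>j. j < n \<Longrightarrow> c j \<noteq> {}"
  shows "(\<Sum>S\<in>Pow {..<k}. wt n c S) = 2 ^ (k - 1) * int n"
proof -
  have "(\<Sum>S\<in>Pow {..<k}. wt n c S) = (\<Sum>j<n. \<Sum>S\<in>Pow {..<k}. chi S (c j))"
    unfolding wt_def by (rule sum.swap)
  also have "\<dots> = (\<Sum>j<n. 2 ^ (k - 1))"
    using assms by (intro sum.cong) (simp_all add: sum_chi_Pow)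
  finally show ?thesis by simp
qed

text \<open>The factor \<open>1 - chi S p\<close> selects the words that vanish on the column
  \<open>p\<close>. Coordinates with column \<open>p\<close> contribute nothing to them, while any
  other nonzero column contributes to half of them.\<close>

lemma sum_wt_even:
  assumes c: "\<And>j. j < n \<Longrightarrow> c j \<subseteq> {..<k}" "\<And>j. j < n \<Longrightarrow> c j \<noteq> {}"
    and p: "p \<subseteq> {..<k}" "p \<noteq> {}"
  shows "2 * (\<Sum>S\<in>Pow {..<k}. (1 - chi S p) * wt n c S) =
      2 ^ (k - 1) * int (card {j. j < n \<and> c j \<noteq> p})"
proof -
  have "2 * ((1 - chi S p) * chi S q) = chi S q - chi S p + chi S (sym_diff p q)"
    if "S \<in> Pow {..<k}" for S q
    using chi_mult_chi[of S p q] that finite_subset[of S "{..<k}"] by (simp add: algebra_simps)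
  then have "2 * (\<Sum>S\<in>Pow {..<k}. (1 - chi S p) * wt n c S) =
      (\<Sum>S\<in>Pow {..<k}. \<Sum>j<n. chi S (c j) - chi S p + chi S (sym_diff p (c j)))"
    unfolding wt_def sum_distrib_left by (intro sum.cong) simp_all
  also have "\<dots> = (\<Sum>j<n. \<Sum>S\<in>Pow {..<k}. chi S (c j) - chi S p + chi S (sym_diff p (c j)))"
    by (rule sum.swap)
  also have "\<dots> = (\<Sum>j<n. if c j \<noteq> p then 2 ^ (k - 1) else 0)"
  proof (intro sum.cong refl)
    fix j assume "j \<in> {..<n}"
    then have *: "c j \<subseteq> {..<k}" "c j \<noteq> {}" "sym_diff p (c j) \<subseteq> {..<k}" using c p by auto
    have "sym_diff p (c j) = {} \<longleftrightarrow> c j = p" by auto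
    then have "(\<Sum>S\<in>Pow {..<k}. chi S (sym_diff p (c j))) = (if c j \<noteq> p then 2 ^ (k - 1) else 0)"
      using sum_chi_Pow[OF _ *(3)] by simp
    then show "(\<Sum>S\<in>Pow {..<k}. chi S (c j) - chi S p + chi S (sym_diff p (c j))) =
        (if c j \<noteq> p then 2 ^ (k - 1) else 0)"
      using * p by (simp add: sum.distrib sum_subtractf sum_chi_Pow[of "{..<k}"])
  qed
  also have "\<dots> = 2 ^ (k - 1) * int (card {j. j < n \<and> c j \<noteq> p})"
    by (simp add: sum.If_cases Int_def)
  finally show ?thesis .
qed

text \<open>Second moment: in the expanded square every pair of coordinates contributes the same
  amount, and a pair with equal columns contributes it twice, because its symmetric difference is
  empty. Repeated columns thus raise the variance.\<close>

lemma sum_wt_squared: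
  assumes c: "\<And>j. j < n \<Longrightarrow> c j \<subseteq> {..<k}" "\<And>j. j < n \<Longrightarrow> c j \<noteq> {}"
  shows "2 * (\<Sum>S\<in>Pow {..<k}. (wt n c S)\<^sup>2) =
      2 ^ (k - 1) * (int n ^ 2 + int (card {(i, j). i < n \<and> j < n \<and> c i = c j}))"
proof -
  have "2 * (wt n c S)\<^sup>2 = (\<Sum>i<n. \<Sum>j<n. chi S (c i) + chi S (c j) - chi S (sym_diff (c i) (c j)))"
    if "S \<in> Pow {..<k}" for S
    using that finite_subset[of S "{..<k}"]
    unfolding wt_def power2_eq_square sum_product
    by (simp only: sum_distrib_left chi_mult_chi Pow_iff finite_lessThan)
  then have "2 * (\<Sum>S\<in>Pow {..<k}. (wt n c S)\<^sup>2) =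
      (\<Sum>S\<in>Pow {..<k}. \<Sum>i<n. \<Sum>j<n. chi S (c i) + chi S (c j) - chi S (sym_diff (c i) (c j)))"
    unfolding sum_distrib_left by (intro sum.cong) auto
  also have "\<dots> = (\<Sum>i<n. \<Sum>S\<in>Pow {..<k}. \<Sum>j<n. chi S (c i) + chi S (c j) - chi S (sym_diff (c i) (c j)))"
    by (rule sum.swap)
  also have "\<dots> = (\<Sum>i<n. \<Sum>j<n. \<Sum>S\<in>Pow {..<k}. chi S (c i) + chi S (c j) - chi S (sym_diff (c i) (c j)))"
    by (intro sum.cong refl sum.swap)
  also have "\<dots> = (\<Sum>i<n. \<Sum>j<n. 2 ^ (k - 1) * (1 + of_bool (c i = c j)))"
  proof (intro sum.cong refl)
    fix i j assume "i \<in> {..<n}" "j \<in> {..<n}"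
    then have *: "c i \<subseteq> {..<k}" "c i \<noteq> {}" "c j \<subseteq> {..<k}" "c j \<noteq> {}" "sym_diff (c i) (c j) \<subseteq> {..<k}"
      using c by auto
    have "sym_diff (c i) (c j) = {} \<longleftrightarrow> c i = c j" by auto
    then have "(\<Sum>S\<in>Pow {..<k}. chi S (sym_diff (c i) (c j))) = (if c i \<noteq> c j then 2 ^ (k - 1) else 0)"
      using sum_chi_Pow[OF _ *(5)] by simp
    then show "(\<Sum>S\<in>Pow {..<k}. chi S (c i) + chi S (c j) - chi S (sym_diff (c i) (c j))) =
        2 ^ (k - 1) * (1 + of_bool (c i = c j))"
      using * by (simp add: sum.distrib sum_subtractf sum_chi_Pow[of "{..<k}"])
  qed
  also have "\<dots> = 2 ^ (k - 1) * (int n ^ 2 + (\<Sum>i<n. \<Sum>j<n. of_bool (c i = c j)))"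
    by (simp only: sum_distrib_left[symmetric] sum.distrib) (simp add: power2_eq_square)
  also have "(\<Sum>i<n. \<Sum>j<n. of_bool (c i = c j) :: int) = int (card {(i, j). i < n \<and> j < n \<and> c i = c j})"
  proof -
    have "{(i, j). i < n \<and> j < n \<and> c i = c j} = (SIGMA i:{..<n}. {j. j < n \<and> c i = c j})" by auto
    moreover have "(\<Sum>j<n. of_bool (c i = c j)) = int (card {j. j < n \<and> c i = c j})" for i
      by (simp add: Int_def)
    ultimately show ?thesis by simp
  qed
  finally show ?thesis .
qed

lemma card_word_eq_wt:
  assumes "generator_matrix n k G C" "S \<subseteq> {..<k}"
  shows "int (card (row_comb G S)) = wt n (col k G) S"
proof -
  have "row_comb G S = {j \<in> {..<n}. odd (card (S \<inter> col k G j))}"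
    using generator_matrix_word_subset[OF assms] row_comb_iff_col[OF assms(2)] by auto
  then show ?thesis by (simp add: wt_def chi_def Int_def)
qed

lemma card_word_eq_mult:
  assumes "generator_matrix n k G C" "S \<subseteq> {..<k}"
  shows "card (row_comb G S) = (\<Sum>p\<in>Pow {..<k}. of_bool (odd (card (S \<inter> p))) * mult n k G p)"
proof -
  have "row_comb G S = (\<Union>p\<in>{p \<in> Pow {..<k}. odd (card (S \<inter> p))}. {j. j < n \<and> col k G j = p})"
    using generator_matrix_word_subset[OF assms] row_comb_iff_col[OF assms(2)] col_subset by auto
  then have "card (row_comb G S) = (\<Sum>p\<in>{p \<in> Pow {..<k}. odd (card (S \<inter> p))}. mult n k G p)"
    unfolding mult_def by (simp only:) (rule card_UN_disjoint, auto)
  also have "\<dots> = (\<Sum>p\<in>Pow {..<k}. of_bool (odd (card (S \<inter> p))) * mult n k G p)"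
    by (intro sum.mono_neutral_cong_left) auto
  finally show ?thesis .
qed

lemma sum_mult: "(\<Sum>p\<in>Pow {..<k}. mult n k G p) = n"
proof -
  have "{..<n} = (\<Union>p\<in>Pow {..<k}. {j. j < n \<and> col k G j = p})" using col_subset by auto
  then have "card {..<n} = (\<Sum>p\<in>Pow {..<k}. mult n k G p)"
    unfolding mult_def by (subst card_UN_disjoint[symmetric]) auto
  then show ?thesis by simp
qed

section \<open>Minimum distance and CIS codes\<close>

lemma min_dist_le:
  assumes "generator_matrix n k G C" "S \<subseteq> {..<k}" "S \<noteq> {}"
  shows "min_dist C \<le> card (row_comb G S)"
proof -
  have "finite C" using generator_matrix_code[OF assms(1)] by simp
  moreover have "row_comb G S \<in> C - {{}}" using assms by (auto simp: generator_matrix_def)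
  ultimately show ?thesis unfolding min_dist_def by (intro Min_le) auto
qed

lemma CIS_generator_matrix: "CIS t k C \<Longrightarrow> \<exists>G. generator_matrix (t * k) k G C"
  by (simp add: CIS_def binary_linear_code_def)

text \<open>Coordinates that agree in all words have equal columns, and two equal columns sum to
  zero.\<close>

lemma information_set_no_twins:
  assumes "information_set n k C I" "J \<subseteq> I" "\<And>i j c. i \<in> J \<Longrightarrow> j \<in> J \<Longrightarrow> c \<in> C \<Longrightarrow> i \<in> c \<longleftrightarrow> j \<in> c"
  shows "card J \<le> 1"
proof (rule ccontr)
  assume "\<not> card J \<le> 1"
  then obtain i j where ij: "i \<in> J" "j \<in> J" "i \<noteq> j"
    by (metis card_le_Suc0_iff_eq card.infinite One_nat_def le0)
  from assms(1) obtain G where G: "generator_matrix n k G C" "columns_independent k G I"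
    unfolding information_set_def by blast
  have "{i, j} \<subseteq> I" using ij assms(2) by auto
  then obtain l where l: "l < k" "odd (card {x \<in> {i, j}. x \<in> G l})"
    using G(2) unfolding columns_independent_def by blast
  have "col k G i = col k G j" unfolding col_eq_iff[OF G(1)] using assms(3) ij by blast
  then have "i \<in> G l \<longleftrightarrow> j \<in> G l" using l(1) by (auto simp: col_def)
  then have "{x \<in> {i, j}. x \<in> G l} = (if i \<in> G l then {i, j} else {})" by auto
  then show False using l(2) ij(3) by (auto split: if_splits)
qed

text \<open>Each coordinate lies in an information set, where a zero column would be dependent. That
  set may come with another generator matrix; \<open>col_empty_iff\<close> carries the conclusion
  over.\<close>

lemma CIS_col_nonempty:
  assumes "CIS t k C" "generator_matrix (t * k) k G C" "j < t * k"
  shows "col k G j \<noteq> {}"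
proof -
  from assms(1) obtain P where P: "\<forall>i<t. information_set (t * k) k C (P i)" "(\<Union>i<t. P i) = {..<t * k}"
    unfolding CIS_def by blast
  have "j \<in> (\<Union>i<t. P i)" using assms(3) P(2) by simp
  then obtain i where i: "i < t" "j \<in> P i" by auto
  then obtain H where H: "generator_matrix (t * k) k H C" "columns_independent k H (P i)"
    using P(1) unfolding information_set_def by blast
  have "{j} \<subseteq> P i" using i by simp
  then obtain l where l: "l < k" "odd (card {x \<in> {j}. x \<in> H l})"
    using H(2) unfolding columns_independent_def by blast
  have "{x \<in> {j}. x \<in> H l} = (if j \<in> H l then {j} else {})" by auto
  then have "col k H j \<noteq> {}" using l by (auto simp: col_def split: if_splits)
  then show ?thesis using col_empty_iff[OF H(1)] col_empty_iff[OF assms(2)] by simp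
qed

text \<open>Each of the \<open>t\<close> information sets contains at most one coordinate with a
  given column.\<close>

lemma CIS_mult_le:
  assumes "CIS t k C" "generator_matrix (t * k) k G C"
  shows "mult (t * k) k G p \<le> t"
proof -
  from assms(1) obtain P where P: "\<forall>i<t. information_set (t * k) k C (P i)" "(\<Union>i<t. P i) = {..<t * k}"
    unfolding CIS_def by blast
  define J where "J = {j. j < t * k \<and> col k G j = p}"
  have "card (J \<inter> P i) \<le> 1" if "i < t" for i
    by (rule information_set_no_twins[of "t * k" k C "P i"])
      (use P(1) that col_eq_iff[OF assms(2)] in \<open>auto simp: J_def\<close>)
  moreover have "J = (\<Union>i<t. J \<inter> P i)" using P(2) by (auto simp: J_def)
  then have "card J \<le> (\<Sum>i<t. card (J \<inter> P i))" by (metis card_UN_le finite_lessThan)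
  ultimately have "card J \<le> (\<Sum>i<t. 1)" by (meson lessThan_iff order_trans sum_mono)
  then show ?thesis by (simp add: mult_def J_def)
qed

lemma CIS_mult_empty:
  assumes "CIS t k C" "generator_matrix (t * k) k G C"
  shows "mult (t * k) k G {} = 0"
  using CIS_col_nonempty[OF assms] by (auto simp: mult_def)

lemma CIS_Plotkin_bound:
  assumes "CIS t k C"
  shows "(2 ^ k - 1) * min_dist C \<le> 2 ^ (k - 1) * (t * k)"
proof -
  obtain G where G: "generator_matrix (t * k) k G C" using CIS_generator_matrix[OF assms] ..
  have "int ((2 ^ k - 1) * min_dist C) = (\<Sum>S\<in>Pow {..<k} - {{}}. int (min_dist C))"
    by (simp add: card_Diff_subset card_Pow)
  also have "\<dots> \<le> (\<Sum>S\<in>Pow {..<k} - {{}}. wt (t * k) (col k G) S)"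
    using min_dist_le[OF G] card_word_eq_wt[OF G]
    by (intro sum_mono) (metis DiffE Pow_iff insertI1 of_nat_le_iff)
  also have "\<dots> = (\<Sum>S\<in>Pow {..<k}. wt (t * k) (col k G) S)"
    by (intro sum.mono_neutral_left) auto
  also have "\<dots> = 2 ^ (k - 1) * int (t * k)"
    using CIS_col_nonempty[OF assms G] col_subset by (intro sum_wt) auto
  finally show ?thesis by (metis of_nat_le_iff of_nat_mult of_nat_numeral of_nat_power)
qed

section \<open>Optimal codes of dimension 4 and 5\<close>

text \<open>Counting modulo 2 the incidences between rows in \<open>S\<close> and coordinates shows
  that the parity of the weight is linear. A parity bit therefore amounts to one more
  column.\<close>

lemma odd_card_row_comb:
  assumes G: "generator_matrix n k G C" and S: "S \<subseteq> {..<k}"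
  shows "odd (card (row_comb G S)) \<longleftrightarrow> odd (card {i \<in> S. odd (card (G i))})"
proof -
  have fin: "finite S" using S by (rule finite_subset) simp
  have word: "row_comb G S = {j \<in> {..<n}. odd (card {i \<in> S. j \<in> G i})}"
    using generator_matrix_word_subset[OF G S] by (auto simp: row_comb_def)
  have "(\<Sum>j<n. card {i \<in> S. j \<in> G i}) = (\<Sum>j<n. \<Sum>i\<in>S. of_bool (j \<in> G i))"
    using fin by (simp add: Int_def)
  also have "\<dots> = (\<Sum>i\<in>S. \<Sum>j<n. of_bool (j \<in> G i))" by (rule sum.swap)
  also have "\<dots> = (\<Sum>i\<in>S. card (G i))"
  proof (intro sum.cong refl)
    fix i assume "i \<in> S"
    then have "{..<n} \<inter> {j. j \<in> G i} = G i" using G S by (auto simp: generator_matrix_def)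
    then show "(\<Sum>j<n. of_bool (j \<in> G i)) = card (G i)" by simp
  qed
  finally have "even (\<Sum>j<n. card {i \<in> S. j \<in> G i}) \<longleftrightarrow> even (\<Sum>i\<in>S. card (G i))" by simp
  then show ?thesis using fin by (simp add: even_sum_iff word)
qed

lemma card_subsets_containing:
  assumes "i < k"
  shows "card {p \<in> Pow {..<k}. i \<in> p} = 2 ^ (k - 1)"
proof -
  have "chi p {i} = of_bool (i \<in> p)" for p by (cases "i \<in> p") (simp_all add: chi_def)
  then have "int (card {p \<in> Pow {..<k}. i \<in> p}) = (\<Sum>p\<in>Pow {..<k}. chi p {i})" by (simp add: Int_def)
  also have "\<dots> = int (2 ^ (k - 1))" using assms by (simp add: sum_chi_Pow)
  finally show ?thesis by (simp only: of_nat_eq_iff)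
qed

lemma card_row_eq_sum_mult:
  assumes "generator_matrix n k G C" "i < k"
  shows "card (G i) = (\<Sum>p\<in>{p \<in> Pow {..<k}. i \<in> p}. mult n k G p)"
proof -
  have "card (G i) = (\<Sum>p\<in>Pow {..<k}. of_bool (odd (card ({i} \<inter> p))) * mult n k G p)"
    using card_word_eq_mult[OF assms(1), of "{i}"] assms(2) by simp
  also have "\<dots> = (\<Sum>p\<in>{p \<in> Pow {..<k}. i \<in> p}. mult n k G p)"
    by (intro sum.mono_neutral_cong_right) auto
  finally show ?thesis .
qed

lemma inj_col_iff:
  assumes "generator_matrix n k G C" "generator_matrix n k H C"
  shows "inj_on (col k G) {..<n} \<longleftrightarrow> inj_on (col k H) {..<n}"
  unfolding inj_on_def col_eq_iff[OF assms(1)] col_eq_iff[OF assms(2)] ..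

lemma inj_col_iff_mult: "inj_on (col k G) {..<n} \<longleftrightarrow> (\<forall>p. mult n k G p \<le> 1)"
proof
  assume inj: "inj_on (col k G) {..<n}"
  show "\<forall>p. mult n k G p \<le> 1"
  proof
    fix p
    show "mult n k G p \<le> 1"
      using inj by (auto simp: mult_def card_le_Suc0_iff_eq inj_on_def)
  qed
next
  assume *: "\<forall>p. mult n k G p \<le> 1"
  show "inj_on (col k G) {..<n}"
  proof (rule inj_onI)
    fix i j assume "i \<in> {..<n}" "j \<in> {..<n}" "col k G i = col k G j"
    moreover have "card {x. x < n \<and> col k G x = col k G j} \<le> Suc 0"
      using * by (simp add: mult_def)
    ultimately show "i = j" by (auto simp: card_le_Suc0_iff_eq)
  qed
qed

text \<open>The diagonal supplies \<open>n\<close> such pairs, and a count of at most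
  \<open>n\<close> leaves no others.\<close>

lemma card_equal_pairs_ge:
  fixes c :: "nat \<Rightarrow> nat set"
  shows "n \<le> card {(i, j). i < n \<and> j < n \<and> c i = c j}"
    and "card {(i, j). i < n \<and> j < n \<and> c i = c j} \<le> n \<Longrightarrow> inj_on c {..<n}"
proof -
  let ?N = "{(i, j). i < n \<and> j < n \<and> c i = c j}" and ?D = "(\<lambda>i. (i, i)) ` {..<n}"
  have D: "card ?D = n" "?D \<subseteq> ?N" by (auto simp: card_image inj_on_def)
  have fin: "finite ?N" by (rule finite_subset[of _ "{..<n} \<times> {..<n}"]) auto
  show "n \<le> card ?N" using card_mono[OF fin D(2)] D(1) by simp
  assume "card ?N \<le> n"
  then have "?D = ?N" using fin D by (intro card_seteq) auto
  then show "inj_on c {..<n}" by (force simp: inj_on_def)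
qed

text \<open>The columns are the points of the projective space PG(3,2) outside a line; rows 0 and 1
  are the two equations of that line.\<close>

lemma CIS_12_4_6_normal_form:
  assumes D: "CIS 3 4 D" "min_dist D = 6"
  shows "\<exists>H. generator_matrix 12 4 H D \<and> (\<forall>p\<subseteq>{..<4}. mult 12 4 H p = of_bool (p \<inter> {0, 1} \<noteq> {}))"
proof -
  obtain G where G: "generator_matrix 12 4 G D" using CIS_generator_matrix[OF D(1)] by auto
  define w where "w = wt 12 (col 4 G)"
  have c: "col 4 G j \<subseteq> {..<4}" "j < 12 \<Longrightarrow> col 4 G j \<noteq> {}" for j
    using CIS_col_nonempty[OF D(1)] G col_subset by auto
  let ?P = "Pow {..<4::nat}" and ?P' = "Pow {..<4::nat} - {{}}"
  have card_P': "card ?P' = 15" by (simp add: card_Diff_subset card_Pow)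
  have drop0: "sum f ?P' = sum f ?P - f {}" for f :: "nat set \<Rightarrow> int"
    by (subst sum_diff1) auto
  have w6: "6 \<le> w S" if "S \<in> ?P'" for S
    using min_dist_le[OF G, of S] card_word_eq_wt[OF G, of S] that D(2) by (auto simp: w_def)
  have w0: "w {} = 0" by (simp add: w_def)
  have "mult 12 4 G p \<le> 1" for p
  proof (cases "p \<subseteq> {..<4} \<and> p \<noteq> {}")
    case True
    \<comment> \<open>Seven nonzero coefficient sets have \<open>chi S p = 0\<close>, with total
      weight at least 42. For a column of multiplicity m this total is 4 * (12 - m), hence m \<le>
      1.\<close>
    have "(\<Sum>S\<in>?P'. (1 - chi S p) * 6) \<le> (\<Sum>S\<in>?P'. (1 - chi S p) * w S)"
      using w6 chi_cases by (intro sum_mono mult_left_mono) (auto, smt (verit) chi_cases)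
    also have "\<dots> = (\<Sum>S\<in>?P. (1 - chi S p) * w S)" by (simp add: drop0 w0)
    also have "2 * \<dots> = 8 * int (card {j. j < 12 \<and> col 4 G j \<noteq> p})"
      using sum_wt_even[of 12 "col 4 G" 4 p] c True by (simp add: w_def)
    finally have "2 * (\<Sum>S\<in>?P'. (1 - chi S p) * 6) \<le> 8 * int (card {j. j < 12 \<and> col 4 G j \<noteq> p})" by simp
    moreover have "(\<Sum>S\<in>?P'. (1 - chi S p) * 6) = 42"
      using True by (simp add: drop0 sum_distrib_right[symmetric] sum_subtractf sum_chi_Pow card_Pow)
    moreover have "mult 12 4 G p + card {j. j < 12 \<and> col 4 G j \<noteq> p} = 12"
    proof -
      have "card ({j. j < 12 \<and> col 4 G j = p} \<union> {j. j < 12 \<and> col 4 G j \<noteq> p}) =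
          mult 12 4 G p + card {j. j < 12 \<and> col 4 G j \<noteq> p}"
        unfolding mult_def by (intro card_Un_disjoint) auto
      moreover have "{j. j < 12 \<and> col 4 G j = p} \<union> {j. j < 12 \<and> col 4 G j \<noteq> p} = {..<12}" by auto
      ultimately show ?thesis by simp
    qed
    ultimately show ?thesis by linarith
  next
    case False
    then have none: "{j. j < 12 \<and> col 4 G j = p} = {}" using c by blast
    show ?thesis by (simp add: mult_def none)
  qed
  then have inj: "inj_on (col 4 G) {..<12}" by (simp add: inj_col_iff_mult)
  have w8: "w S \<le> 8" if "S \<in> ?P'" for S
  proof -
    \<comment> \<open>As the columns are distinct, the weight is at most the number of
      \<open>p\<close> meeting \<open>S\<close> oddly, which is 8.\<close>
    have "w S = (\<Sum>p\<in>col 4 G ` {..<12}. chi S p)"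
      unfolding w_def wt_def by (simp only: sum.reindex[OF inj] o_def)
    also have "\<dots> \<le> (\<Sum>p\<in>?P. chi S p)"
      using c by (intro sum_mono2) (auto simp: chi_def)
    also have "\<dots> = (\<Sum>p\<in>?P. chi p S)" by (simp add: chi_def Int_commute)
    also have "\<dots> = 8" using that by (subst sum_chi_Pow) auto
    finally show ?thesis .
  qed
  have sum_w: "(\<Sum>S\<in>?P'. w S) = 96"
    using sum_wt[of 12 "col 4 G" 4] c by (simp add: drop0 w0 w_def)
  have "2 * (\<Sum>S\<in>?P'. (w S)\<^sup>2) \<ge> 8 * (144 + 12)"
    using sum_wt_squared[of 12 "col 4 G" 4] c card_equal_pairs_ge(1)[of 12 "col 4 G"]
    by (simp add: drop0 w0 w_def)
  moreover have "(\<Sum>S\<in>?P'. (w S - 6) * (8 - w S)) = 14 * (\<Sum>S\<in>?P'. w S) - (\<Sum>S\<in>?P'. (w S)\<^sup>2) - 48 * 15"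
  proof -
    have "(w S - 6) * (8 - w S) = 14 * w S - (w S)\<^sup>2 - 48" for S by (simp add: algebra_simps power2_eq_square)
    then show ?thesis by (simp add: sum_subtractf sum_distrib_left card_P')
  qed
  \<comment> \<open>The second moment is at least 624, and 14 * 96 - 624 - 48 * 15 = 0.\<close>
  ultimately have "(\<Sum>S\<in>?P'. (w S - 6) * (8 - w S)) \<le> 0" using sum_w by simp
  moreover have nonneg: "0 \<le> (w S - 6) * (8 - w S)" if "S \<in> ?P'" for S
    using w6[OF that] w8[OF that] by simp
  ultimately have "(\<Sum>S\<in>?P'. (w S - 6) * (8 - w S)) = 0" by (meson antisym sum_nonneg)
  then have "\<forall>S\<in>?P'. (w S - 6) * (8 - w S) = 0" using nonneg by (subst (asm) sum_nonneg_eq_0_iff) auto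
  then have w68: "w S - 6 = 2 * of_bool (w S = 8)" if "S \<in> ?P'" for S using that by auto
  define U where "U = {S \<in> ?P'. w S = 8}"
  \<comment> \<open>The excess over weight 6 totals 96 - 90 = 6 and comes in portions of 2.\<close>
  have "6 = (\<Sum>S\<in>?P'. w S - 6)" using sum_w by (simp add: sum_subtractf card_P')
  also have "\<dots> = (\<Sum>S\<in>?P'. 2 * of_bool (w S = 8))" using w68 by (intro sum.cong) auto
  also have "\<dots> = 2 * int (card U)" by (simp add: sum_distrib_left[symmetric] U_def Int_def)
  finally have "card U = 3" by simp
  moreover have "finite U" "{} \<notin> U" by (simp_all add: U_def)
  \<comment> \<open>The empty set only brings the size up to the four elements required for
    extending to two vectors; independence prevents it from being chosen.\<close>
  ultimately have cU: "card (insert {} U) = 2 ^ 2" by simp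
  have "independent 0 (\<lambda>_. {})" by (simp add: independent_def)
  from independent_extend[OF this, of 2 "insert {} U"] cU
  obtain Q where Q: "independent 2 Q" "\<And>i. i < 2 \<Longrightarrow> Q i \<in> insert {} U" by auto
  have QU: "Q i \<in> U" if "i < 2" for i
  proof -
    have "row_comb Q {i} \<noteq> {}" using Q(1) that unfolding independent_def by (metis empty_not_insert empty_subsetI insert_subset lessThan_iff)
    then show ?thesis using Q(2)[OF that] by simp
  qed
  from independent_extend[OF Q(1), of 4 ?P]
  obtain R where R: "independent 4 R" "\<And>i. i < 2 \<Longrightarrow> R i = Q i" "\<And>i. 2 \<le> i \<Longrightarrow> i < 4 \<Longrightarrow> R i \<in> ?P"
    by (auto simp: card_Pow)
  have Rsub: "R i \<subseteq> {..<4}" if "i < 4" for i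
    using R(2,3)[of i] QU[of i] that unfolding U_def by (cases "i < 2") auto
  define H where "H i = row_comb G (R i)" for i
  have H: "generator_matrix 12 4 H D"
    unfolding H_def by (rule generator_matrix_change_basis[OF G Rsub R(1)])
  have m1: "mult 12 4 H p \<le> 1" for p
    using inj inj_col_iff[OF G H] inj_col_iff_mult by blast
  \<comment> \<open>Only eight columns contain \<open>i\<close>, each of multiplicity at most 1; a
    row of weight 8 needs them all.\<close>
  have row: "mult 12 4 H p = 1" if i: "i < 2" "i \<in> p" "p \<subseteq> {..<4}" for i p
  proof (rule ccontr)
    assume "mult 12 4 H p \<noteq> 1"
    then have "mult 12 4 H p < 1" using m1[of p] by linarith
    then have "(\<Sum>p\<in>{p \<in> ?P. i \<in> p}. mult 12 4 H p) < (\<Sum>p\<in>{p \<in> ?P. i \<in> p}. 1)"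
      using m1 i by (intro sum_strict_mono_ex1) auto
    also have "\<dots> = 8" using card_subsets_containing[of i 4] i by simp
    finally have "card (H i) < 8" using card_row_eq_sum_mult[OF H, of i] i by simp
    moreover have "int (card (H i)) = 8"
      using card_word_eq_wt[OF G, of "R i"] QU[OF i(1)] R(2)[OF i(1)] by (auto simp: H_def U_def w_def)
    ultimately show False by simp
  qed
  let ?A = "{p \<in> ?P. p \<inter> {0, 1} \<noteq> {}}"
  \<comment> \<open>The twelve columns meeting \<open>{0, 1}\<close> already fill the length, so
    those contained in \<open>{2, 3}\<close> do not occur.\<close>
  have "?P - ?A = Pow {2, 3}" by (auto simp: numeral_eq_Suc less_Suc_eq)
  then have "card (?P - ?A) = 4" by (simp add: card_Pow)
  moreover have "card ?P = card ?A + card (?P - ?A)"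
    by (subst card_Un_disjoint[symmetric]) (auto intro: arg_cong[where f = card])
  ultimately have "card ?A = 12" by (simp add: card_Pow)
  moreover have "(\<Sum>p\<in>?A. mult 12 4 H p) = (\<Sum>p\<in>?A. 1)" using row[of 0] row[of 1] by (intro sum.cong) auto
  ultimately have "(\<Sum>p\<in>?A. mult 12 4 H p) = 12" by simp
  moreover have "(\<Sum>p\<in>?P. mult 12 4 H p) = (\<Sum>p\<in>?P - ?A. mult 12 4 H p) + (\<Sum>p\<in>?A. mult 12 4 H p)"
    by (rule sum.subset_diff) auto
  ultimately have "(\<Sum>p\<in>?P - ?A. mult 12 4 H p) = 0" by (simp only: sum_mult)
  then have "\<forall>p\<in>?P - ?A. mult 12 4 H p = 0" by (subst (asm) sum_eq_0_iff) auto
  then have "mult 12 4 H p = 0" if "p \<subseteq> {..<4}" "p \<inter> {0, 1} = {}" for p using that by auto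
  with row[of 0] row[of 1] have "\<forall>p\<subseteq>{..<4}. mult 12 4 H p = of_bool (p \<inter> {0, 1} \<noteq> {})"
    by fastforce
  with H show ?thesis by blast
qed

text \<open>This is the punctured first-order Reed-Muller code: the columns are the points of the
  affine space of dimension 4 other than the origin, with row 4 the all-one word.\<close>

lemma CIS_15_5_7_normal_form:
  assumes D: "CIS 3 5 D" "min_dist D = 7"
  shows "\<exists>H. generator_matrix 15 5 H D \<and> (\<forall>p\<subseteq>{..<5}. mult 15 5 H p = of_bool (4 \<in> p \<and> p \<noteq> {4}))"
proof -
  obtain G where G: "generator_matrix 15 5 G D" using CIS_generator_matrix[OF D(1)] by auto
  let ?P = "Pow {..<5::nat}" and ?P' = "Pow {..<5::nat} - {{}}"
  have card_P': "card ?P' = 31" by (simp add: card_Diff_subset card_Pow)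
  have drop0: "sum f ?P' = sum f ?P - f {}" for f :: "nat set \<Rightarrow> int"
    by (subst sum_diff1) auto
  \<comment> \<open>The column of the parity bit, placed at index 15 as the sixteenth
    coordinate.\<close>
  define z where "z = {i. i < 5 \<and> odd (card (G i))}"
  define c where "c = (col 5 G)(15 := z)"
  define w where "w = wt 16 c"
  have c_old: "col 5 G j \<subseteq> {..<5}" "j < 15 \<Longrightarrow> col 5 G j \<noteq> {}" for j
    using CIS_col_nonempty[OF D(1)] G col_subset by auto
  have w_old: "w S = int (card (row_comb G S)) + chi S z" if "S \<in> ?P" for S
  proof -
    have "w S = (\<Sum>j<15. chi S (c j)) + chi S (c 15)"
      using sum.lessThan_Suc[of "\<lambda>j. chi S (c j)" 15] by (simp add: w_def wt_def)
    also have "\<dots> = wt 15 (col 5 G) S + chi S z" by (simp add: wt_def c_def)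
    finally show ?thesis using card_word_eq_wt[OF G, of S] that by simp
  qed
  have chi_z: "chi S z = of_bool (odd (card (row_comb G S)))" if "S \<in> ?P" for S
  proof -
    have "{i \<in> S. odd (card (G i))} = S \<inter> z" using that by (auto simp: z_def)
    then show ?thesis using odd_card_row_comb[OF G, of S] that by (simp add: chi_def)
  qed
  have w8: "8 \<le> w S" if "S \<in> ?P'" for S
  proof -
    \<comment> \<open>A word of weight 7 is odd and gains the parity bit; every other nonzero word
      already has weight at least 8.\<close>
    have "7 \<le> card (row_comb G S)" using min_dist_le[OF G, of S] that D(2) by auto
    then show ?thesis using w_old[of S] chi_z[of S] that
      by (cases "card (row_comb G S) = 7") auto
  qed
  have w0: "w {} = 0" by (simp add: w_def)
  \<comment> \<open>With a zero parity column the total weight would stay 16 * 15 = 240, below 31 *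
    8 = 248.\<close>
  have "z \<noteq> {}"
  proof
    assume "z = {}"
    then have "w S = wt 15 (col 5 G) S" if "S \<in> ?P" for S
      using w_old[OF that] card_word_eq_wt[OF G, of S] that by simp
    then have "(\<Sum>S\<in>?P'. w S) = 240"
      using sum_wt[of 15 "col 5 G" 5] c_old by (simp add: drop0 w0)
    moreover have "(\<Sum>S\<in>?P'. 8) \<le> (\<Sum>S\<in>?P'. w S)" using w8 by (intro sum_mono) auto
    ultimately show False by (simp add: card_P')
  qed
  then have c: "c j \<subseteq> {..<5}" "j < 16 \<Longrightarrow> c j \<noteq> {}" for j
    using c_old by (auto simp: c_def z_def)
  have w16: "w S \<le> 16" for S
    using sum_mono[of "{..<16}" "\<lambda>j. chi S (c j)" "\<lambda>_. 1"] by (simp add: w_def wt_def chi_def)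
  define N where "N = card {(i, j). i < 16 \<and> j < 16 \<and> c i = c j}"
  have N: "16 \<le> N" unfolding N_def by (rule card_equal_pairs_ge(1))
  have sum_w: "(\<Sum>S\<in>?P'. w S) = 256"
    using sum_wt[of 16 c 5] c by (simp add: drop0 w0 w_def)
  have "2 * (\<Sum>S\<in>?P'. (w S)\<^sup>2) = 16 * (256 + int N)"
    using sum_wt_squared[of 16 c 5] c by (simp add: drop0 w0 w_def N_def)
  moreover have "(\<Sum>S\<in>?P'. (w S - 8) * (16 - w S)) = 24 * (\<Sum>S\<in>?P'. w S) - (\<Sum>S\<in>?P'. (w S)\<^sup>2) - 128 * 31"
  proof -
    have "(w S - 8) * (16 - w S) = 24 * w S - (w S)\<^sup>2 - 128" for S by (simp add: algebra_simps power2_eq_square)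
    then show ?thesis by (simp add: sum_subtractf sum_distrib_left card_P')
  qed
  \<comment> \<open>Here 24 * 256 - 8 * (256 + N) - 128 * 31 = 128 - 8 N, and N \<ge> 16 makes this
    at most 0.\<close>
  ultimately have E: "(\<Sum>S\<in>?P'. (w S - 8) * (16 - w S)) = 8 * (16 - int N)" using sum_w by simp
  have nonneg: "0 \<le> (w S - 8) * (16 - w S)" if "S \<in> ?P'" for S
    using w8[OF that] w16[of S] by simp
  then have "0 \<le> 8 * (16 - int N)" unfolding E[symmetric] by (intro sum_nonneg) auto
  then have "N = 16" using N by simp
  then have inj: "inj_on c {..<16}" by (intro card_equal_pairs_ge(2)) (simp add: N_def)
  \<comment> \<open>All weights are 8 or 16; without a 16 the total would be 248 instead of
    256.\<close>
  have "\<exists>S\<in>?P'. w S = 16"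
  proof (rule ccontr)
    assume *: "\<not> (\<exists>S\<in>?P'. w S = 16)"
    have "(\<Sum>S\<in>?P'. (w S - 8) * (16 - w S)) = 0" using E \<open>N = 16\<close> by simp
    then have "\<forall>S\<in>?P'. (w S - 8) * (16 - w S) = 0" using nonneg by (subst (asm) sum_nonneg_eq_0_iff) auto
    with * have "(\<Sum>S\<in>?P'. w S) = (\<Sum>S\<in>?P'. 8)" by (intro sum.cong) auto
    then show False using sum_w by (simp add: card_P')
  qed
  then obtain S0 where S0: "S0 \<in> ?P'" "w S0 = 16" by blast
  \<comment> \<open>The parity bit accounts for at most 1 of the weight 16, so the word itself
    covers all 15 coordinates.\<close>
  have full: "row_comb G S0 = {..<15}"
  proof (rule card_seteq)
    show "row_comb G S0 \<subseteq> {..<15}" using generator_matrix_word_subset[OF G] S0 by auto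
    show "card {..<15::nat} \<le> card (row_comb G S0)" using w_old[of S0] S0 chi_cases[of S0 z] by auto
  qed simp
  have inj_G: "inj_on (col 5 G) {..<15}"
  proof -
    have "inj_on c {..<15}" by (rule inj_on_subset[OF inj]) auto
    then show ?thesis by (rule inj_on_cong[THEN iffD1, rotated]) (simp add: c_def)
  qed
  \<comment> \<open>The even words, as coefficient sets; they are half of the 32 because
    \<open>z\<close> is nonempty.\<close>
  define U where "U = {S \<in> ?P. even (card (row_comb G S))}"
  have "int (card U) = (\<Sum>S\<in>?P. 1 - chi S z)"
  proof -
    have "(\<Sum>S\<in>?P. 1 - chi S z) = (\<Sum>S\<in>?P. of_bool (even (card (row_comb G S))))"
      using chi_z by (intro sum.cong) auto
    then show ?thesis by (simp add: U_def Int_def)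
  qed
  also have "\<dots> = 16"
    using c(1)[of 15] \<open>z \<noteq> {}\<close> by (simp add: sum_subtractf sum_chi_Pow card_Pow c_def)
  finally have "card U = 2 ^ 4" by simp
  moreover have "independent 0 (\<lambda>_. {})" by (simp add: independent_def)
  ultimately obtain Q where Q: "independent 4 Q" "\<And>i. i < 4 \<Longrightarrow> Q i \<in> U"
    using independent_extend[of 0 "\<lambda>_. {}" 4 U] by auto
  \<comment> \<open>Combinations of even words are even, whereas the all-one word has odd weight
    15.\<close>
  have "S0 \<notin> row_comb Q ` Pow {..<4}"
  proof
    assume "S0 \<in> row_comb Q ` Pow {..<4}"
    then obtain T where T: "T \<subseteq> {..<4}" "S0 = row_comb Q T" by auto
    have fT: "finite T" using T(1) by (rule finite_subset) simp
    have "odd (card (row_comb G (row_comb Q T)))" using full T(2) by simp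
    moreover have "even (card (row_comb G (row_comb Q T)))"
      using fT T(1)
    proof (induction T)
      case (insert i T)
      have Qi: "Q i \<in> U" using Q(2) insert.prems by auto
      have sub: "row_comb Q T \<subseteq> {..<5}"
        using insert Q(2) by (intro row_comb_subset) (auto simp: U_def)
      have "finite (Q i)" "finite (row_comb Q T)" "finite (row_comb G (Q i))" "finite (row_comb G (row_comb Q T))"
        using Qi sub generator_matrix_word_subset[OF G] by (auto simp: U_def intro: finite_subset)
      then have "odd (card (row_comb G (row_comb Q (insert i T)))) \<longleftrightarrow>
          odd (card (row_comb G (Q i))) \<noteq> odd (card (row_comb G (row_comb Q T)))"
        using insert.hyps odd_card_sym_diff by (simp add: row_comb_insert row_comb_sym_diff)
      then show ?case using insert Qi by (auto simp: U_def)
    qed simp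
    ultimately show False by simp
  qed
  then have indep: "independent 5 (Q(4 := S0))" using independent_upd[OF Q(1)] by simp
  define H where "H i = row_comb G ((Q(4 := S0)) i)" for i
  have sub: "(Q(4 := S0)) i \<subseteq> {..<5}" if "i < 5" for i
    using Q(2)[of i] that S0(1) by (auto simp: U_def)
  have H: "generator_matrix 15 5 H D"
    unfolding H_def by (rule generator_matrix_change_basis[OF G sub indep])
  have H4: "H 4 = {..<15}" by (simp add: H_def full)
  have Heven: "even (card (H i))" if "i < 4" for i
    using Q(2)[OF that] that by (simp add: H_def U_def)
  have m1: "mult 15 5 H p \<le> 1" for p
    using inj_G inj_col_iff[OF G H] inj_col_iff_mult by blast
  have m0: "mult 15 5 H p = 0" if "4 \<notin> p" for p
  proof -
    have "4 \<in> col 5 H j" if "j < 15" for j using that by (simp add: col_def H4)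
    then have "{j. j < 15 \<and> col 5 H j = p} = {}" using that by blast
    then show ?thesis by (simp add: mult_def)
  qed
  let ?A = "{p \<in> ?P. 4 \<in> p}"
  \<comment> \<open>The columns through row 4 that do not occur: 15 of the 16 candidates are used,
    so exactly one is missing.\<close>
  define M where "M = {p \<in> ?A. mult 15 5 H p = 0}"
  have m_M: "mult 15 5 H p + of_bool (p \<in> M) = 1" if "p \<in> ?A" for p
    using m1[of p] that by (auto simp: M_def le_Suc_eq)
  have sum_A: "(\<Sum>p\<in>B. mult 15 5 H p) + card (B \<inter> M) = card B" if "B \<subseteq> ?A" for B
  proof -
    have "finite B" using that by (rule finite_subset) simp
    moreover have "(\<Sum>p\<in>B. mult 15 5 H p + of_bool (p \<in> M)) = (\<Sum>p\<in>B. 1)"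
      using m_M that by (intro sum.cong refl) blast
    ultimately show ?thesis by (simp add: sum.distrib Int_def)
  qed
  have "card (?A \<inter> M) = 1"
    using sum_A[of ?A] card_row_eq_sum_mult[OF H, of 4] card_subsets_containing[of 4 5] H4 by simp
  moreover have "?A \<inter> M = M" by (auto simp: M_def)
  ultimately obtain q where q: "M = {q}" by (metis card_1_singletonE)
  \<comment> \<open>If the missing column had a one in a row \<open>i < 4\<close>, that row would
    have only 7 of its 8 possible columns, contradicting its even weight.\<close>
  have "q = {4}"
  proof (rule ccontr)
    assume "q \<noteq> {4}"
    moreover have sub_q: "q \<subseteq> {..<5}" "4 \<in> q" using q by (auto simp: M_def)
    ultimately obtain i where i: "i \<in> q" "i \<noteq> 4" by blast
    then have "i < 5" using sub_q by auto
    with i(2) have i4: "i < 4" by linarith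
    let ?B = "{p \<in> ?A. i \<in> p}"
    have "card (H i) = (\<Sum>p\<in>{p \<in> ?P. i \<in> p}. mult 15 5 H p)"
      by (rule card_row_eq_sum_mult[OF H \<open>i < 5\<close>])
    also have "\<dots> = (\<Sum>p\<in>?B. mult 15 5 H p)"
    proof (rule sum.mono_neutral_right)
      show "\<forall>p\<in>{p \<in> ?P. i \<in> p} - ?B. mult 15 5 H p = 0" using m0 by blast
    qed auto
    finally have "card (H i) + card (?B \<inter> M) = card ?B" using sum_A[of ?B] by auto
    moreover have "?B \<inter> M = {q}" using q i sub_q by auto
    moreover have "card ?B = 8"
    proof -
      have "chi p {a} = of_bool (a \<in> p)" for p a by (cases "a \<in> p") (simp_all add: chi_def)
      \<comment> \<open>The sets containing both \<open>i\<close> and 4 are counted by linearizing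
        the product: twice their number is 16 + 16 - 16.\<close>
      then have "2 * int (card ?B) = (\<Sum>p\<in>?P. 2 * (chi p {i} * chi p {4}))"
        by (simp add: sum_distrib_left[symmetric] of_bool_conj[symmetric] Int_def conj_commute conj_left_commute)
      also have "\<dots> = (\<Sum>p\<in>?P. chi p {i} + chi p {4} - chi p {i, 4})"
      proof (intro sum.cong refl)
        fix p assume "p \<in> ?P"
        then have "finite p" by (auto intro: finite_subset)
        moreover have "sym_diff {i} {4} = {i, 4}" using i by auto
        ultimately show "2 * (chi p {i} * chi p {4}) = chi p {i} + chi p {4} - chi p {i, 4}"
          using chi_mult_chi[of p "{i}" "{4}"] by simp
      qed
      also have "\<dots> = 16" using i4 by (simp add: sum.distrib sum_subtractf sum_chi_Pow)
      finally show ?thesis by simp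
    qed
    ultimately have "Suc (card (H i)) = 8" by simp
    then show False using Heven[OF i4] by presburger
  qed
  have "mult 15 5 H p = of_bool (4 \<in> p \<and> p \<noteq> {4})" if "p \<subseteq> {..<5}" for p
    using m0[of p] m_M[of p] that q \<open>q = {4}\<close> by (cases "p = {4}"; cases "4 \<in> p") simp_all
  with H show ?thesis by blast
qed

section \<open>Codes given by a list of columns\<close>

text \<open>A code is entered by columns, each as a list of row indices, since multiplicities of
  columns are what the normal forms prescribe and lists can be evaluated.\<close>

definition matrix_of :: "nat list list \<Rightarrow> nat \<Rightarrow> nat set" where
  "matrix_of cs i = {j. j < length cs \<and> i \<in> set (cs ! j)}"

definition code_of :: "nat \<Rightarrow> nat list list \<Rightarrow> nat set set" where
  "code_of k cs = row_comb (matrix_of cs) ` Pow {..<k}"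

definition odd_count :: "('a \<Rightarrow> bool) \<Rightarrow> 'a list \<Rightarrow> bool" where
  "odd_count Q xs = foldr (\<lambda>x b. Q x \<noteq> b) xs False"

lemma odd_count_iff:
  assumes "distinct xs"
  shows "odd_count Q xs \<longleftrightarrow> odd (card {x \<in> set xs. Q x})"
proof -
  have "odd_count Q xs \<longleftrightarrow> odd (length (filter Q xs))"
    by (induction xs) (auto simp: odd_count_def)
  then show ?thesis using assms by (metis distinct_card distinct_filter set_filter)
qed

definition word :: "nat list list \<Rightarrow> nat list \<Rightarrow> nat list" where
  "word cs T = filter (\<lambda>j. odd_count (\<lambda>i. i \<in> set (cs ! j)) T) [0..<length cs]"

text \<open>The information sets tested here are the three blocks of \<open>k\<close> consecutive columns.\<close>

definition cis_check :: "nat \<Rightarrow> nat \<Rightarrow> nat list list \<Rightarrow> bool" where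
  "cis_check k d cs \<longleftrightarrow> length cs = 3 * k \<and> 0 < d \<and> (\<forall>c\<in>set cs. \<forall>i\<in>set c. i < k) \<and>
     (\<forall>T\<in>set (subseqs [0..<k]). T \<noteq> [] \<longrightarrow> d \<le> length (word cs T)) \<and>
     (\<exists>T\<in>set (subseqs [0..<k]). length (word cs T) = d) \<and>
     (\<forall>b\<in>set [0..<3]. \<forall>J\<in>set (subseqs [b * k..<b * k + k]). J \<noteq> [] \<longrightarrow>
        (\<exists>i\<in>set [0..<k]. odd_count (\<lambda>j. i \<in> set (cs ! j)) J))"

lemma subset_lessThan_iff_subseqs: "S \<subseteq> {..<k} \<longleftrightarrow> (\<exists>T\<in>set (subseqs [0..<k]). S = set T)"
  using subseqs_powset[of "[0..<k]"] by (auto simp: image_iff atLeast0LessThan set_eq_iff)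

lemma row_comb_matrix_of:
  assumes "T \<in> set (subseqs [0..<k])"
  shows "row_comb (matrix_of cs) (set T) = set (word cs T)"
proof -
  have "distinct T" using assms subseqs_distinctD by fastforce
  note odd_count_iff[OF this]
  moreover have "{i \<in> set T. j \<in> matrix_of cs i} = (if j < length cs then {i \<in> set T. i \<in> set (cs ! j)} else {})" for j
    by (auto simp: matrix_of_def)
  ultimately show ?thesis by (auto simp: row_comb_def word_def)
qed

lemma card_set_word [simp]: "card (set (word cs T)) = length (word cs T)"
  by (rule distinct_card) (simp add: word_def)

lemma col_matrix_of:
  assumes "\<forall>c\<in>set cs. \<forall>i\<in>set c. i < k" "j < length cs"
  shows "col k (matrix_of cs) j = set (cs ! j)"
  using assms nth_mem by (fastforce simp: col_def matrix_of_def)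

lemma mult_matrix_of:
  assumes "\<forall>c\<in>set cs. \<forall>i\<in>set c. i < k"
  shows "mult (length cs) k (matrix_of cs) p = length (filter (\<lambda>c. set c = p) cs)"
  unfolding mult_def length_filter_conv_card
  using col_matrix_of[OF assms] by (intro arg_cong[where f = card]) auto

text \<open>A positive lower bound on the weights of all nonempty combinations is at the same time
  linear independence of the rows.\<close>

lemma cis_check_generator_matrix:
  assumes "cis_check k d cs"
  shows "generator_matrix (3 * k) k (matrix_of cs) (code_of k cs)"
proof -
  have "row_comb (matrix_of cs) S \<noteq> {}" if S: "S \<subseteq> {..<k}" "S \<noteq> {}" for S
  proof -
    obtain T where T: "T \<in> set (subseqs [0..<k])" "S = set T"
      using S(1) subset_lessThan_iff_subseqs[of S k] by blast
    moreover have "T \<noteq> []" using T(2) S(2) by auto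
    ultimately have "d \<le> length (word cs T)" "0 < d" using assms by (simp_all add: cis_check_def)
    then show ?thesis using T(2) row_comb_matrix_of[OF T(1), of cs] by auto
  qed
  moreover have "length cs = 3 * k" using assms by (simp add: cis_check_def)
  ultimately show ?thesis by (auto simp: generator_matrix_def matrix_of_def code_of_def)
qed

lemma cis_check_CIS:
  assumes "cis_check k d cs"
  shows "CIS 3 k (code_of k cs)"
proof -
  note G = cis_check_generator_matrix[OF assms]
  define P where "P b = {b * k..<b * k + k}" for b
  have len: "length cs = 3 * k" using assms by (simp add: cis_check_def)
  have sub: "P b \<subseteq> {..<3 * k}" if "b < 3" for b
    using that by (auto simp: P_def numeral_eq_Suc less_Suc_eq)
  have "columns_independent k (matrix_of cs) (P b)" if b: "b < 3" for b
    unfolding columns_independent_def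
  proof (intro allI impI)
    fix J assume J: "J \<subseteq> P b" "J \<noteq> {}"
    then have "J \<in> set ` set (subseqs [b * k..<b * k + k])"
      by (simp add: subseqs_powset P_def)
    then obtain L where L: "L \<in> set (subseqs [b * k..<b * k + k])" "J = set L" by auto
    obtain i where i: "i < k" "odd_count (\<lambda>j. i \<in> set (cs ! j)) L"
    proof -
      have "b \<in> set [0..<3]" "L \<noteq> []" using b L(2) J(2) by auto
      then have "\<exists>i\<in>set [0..<k]. odd_count (\<lambda>j. i \<in> set (cs ! j)) L"
        using assms L(1) unfolding cis_check_def by blast
      then show ?thesis using that by auto
    qed
    have "distinct L" using L(1) subseqs_distinctD by fastforce
    then have "odd (card {j \<in> set L. i \<in> set (cs ! j)})" using i(2) by (simp add: odd_count_iff)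
    moreover have "{j \<in> J. j \<in> matrix_of cs i} = {j \<in> set L. i \<in> set (cs ! j)}"
      using J(1) sub[OF that] L(2) len by (auto simp: matrix_of_def)
    ultimately show "\<exists>i<k. odd (card {j \<in> J. j \<in> matrix_of cs i})" using i by auto
  qed
  then have "\<forall>b<3. information_set (3 * k) k (code_of k cs) (P b)"
    using G sub unfolding information_set_def by (auto simp: P_def)
  moreover have "P a \<inter> P b = {}" if "a < 3" "b < 3" "a \<noteq> b" for a b
    using that by (auto simp: P_def numeral_eq_Suc less_Suc_eq)
  moreover have "(\<Union>b<3. P b) = {..<3 * k}"
    by (auto simp: P_def numeral_eq_Suc lessThan_Suc)
  ultimately show ?thesis using G unfolding CIS_def binary_linear_code_def by blast
qed

lemma cis_check_min_dist:
  assumes "cis_check k d cs"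
  shows "min_dist (code_of k cs) = d"
proof -
  note G = cis_check_generator_matrix[OF assms]
  obtain T where T: "T \<in> set (subseqs [0..<k])" "length (word cs T) = d" "0 < d"
    using assms by (auto simp: cis_check_def)
  have "set (word cs T) \<in> code_of k cs - {{}}"
    using T row_comb_matrix_of[OF T(1), of cs] subset_lessThan_iff_subseqs[of "set T" k]
    by (auto simp: code_of_def image_iff)
  then have "d \<in> card ` (code_of k cs - {{}})" using T(2) by (metis card_set_word image_eqI)
  moreover have "d \<le> card c" if c: "c \<in> code_of k cs - {{}}" for c
  proof -
    obtain S where S: "S \<subseteq> {..<k}" "c = row_comb (matrix_of cs) S"
      using c unfolding code_of_def by blast
    then obtain T where T: "T \<in> set (subseqs [0..<k])" "S = set T"
      using subset_lessThan_iff_subseqs[of S k] by blast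
    have "T \<noteq> []" using c S T by auto
    then show ?thesis using assms T S row_comb_matrix_of by (auto simp: cis_check_def)
  qed
  moreover have "finite (code_of k cs)" by (simp add: code_of_def)
  ultimately show ?thesis unfolding min_dist_def by (intro Min_eqI) auto
qed

lemma code_equiv_code_of:
  assumes "cis_check k d cs" "generator_matrix (3 * k) k H D"
    and "\<And>p. p \<subseteq> {..<k} \<Longrightarrow> mult (3 * k) k H p = length (filter (\<lambda>c. set c = p) cs)"
  shows "code_equiv (3 * k) (code_of k cs) D"
proof (rule code_equiv_if_mult_eq[OF cis_check_generator_matrix[OF assms(1)] assms(2)])
  have "length cs = 3 * k" "\<forall>c\<in>set cs. \<forall>i\<in>set c. i < k" using assms(1) by (simp_all add: cis_check_def)
  then show "mult (3 * k) k (matrix_of cs) p = mult (3 * k) k H p" if "p \<subseteq> {..<k}" for p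
    using assms(3)[OF that] mult_matrix_of[of cs k p] by simp
qed

text \<open>Splits an optimality and uniqueness claim into a concrete code, an upper bound on the
  distance, and a normal form of the column multiplicities.\<close>

lemma unique_optimal_code:
  assumes "cis_check k d cs"
    and "\<And>D. CIS 3 k D \<Longrightarrow> min_dist D \<le> d"
    and "\<And>D. CIS 3 k D \<Longrightarrow> min_dist D = d \<Longrightarrow> \<exists>H. generator_matrix (3 * k) k H D \<and>
           (\<forall>p\<subseteq>{..<k}. mult (3 * k) k H p = length (filter (\<lambda>c. set c = p) cs))"
  shows "\<exists>C. CIS 3 k C \<and> (\<forall>D. CIS 3 k D \<longrightarrow> min_dist D \<le> min_dist C) \<and>
           (\<forall>D. CIS 3 k D \<and> min_dist D = min_dist C \<longrightarrow> code_equiv (3 * k) C D)"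
  using cis_check_CIS[OF assms(1)] cis_check_min_dist[OF assms(1)] code_equiv_code_of[OF assms(1)] assms(2,3)
  by (intro exI[of _ "code_of k cs"]) metis

text \<open>The order of the columns is chosen so that each block of four consecutive ones is a
  basis. The lists below are arranged in the same way, in blocks of five and three.\<close>

definition cols4 :: "nat list list" where
  "cols4 = [[0], [0,2], [0,3], [1], [0,2,3], [1,2], [1,3], [0,1], [1,2,3], [0,1,2], [0,1,3], [0,1,2,3]]"

definition cols5 :: "nat list list" where
  "cols5 = [[0,4], [1,4], [0,1,4], [2,4], [3,4], [0,2,4], [1,2,4], [0,3,4], [0,1,3,4], [2,3,4],
    [0,1,2,4], [1,3,4], [0,2,3,4], [1,2,3,4], [0,1,2,3,4]]"

text \<open>One list for each multiplicity vector in \<open>profiles\<close>, though in another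
  order.\<close>

definition cols3 :: "nat list list list" where
  "cols3 =
    [[[0], [0,1], [0,1,2], [0,1], [0,2], [0,1,2], [0,2], [1,2], [0,1,2]],
     [[0], [1], [0,2], [0,1], [1,2], [0,1,2], [0,2], [1,2], [0,1,2]],
     [[0], [1], [0,1,2], [0,1], [0,2], [0,1,2], [2], [1,2], [0,1,2]],
     [[0], [1], [0,1,2], [0,1], [0,2], [0,1,2], [0,1], [1,2], [0,1,2]],
     [[0], [1], [0,2], [0,1], [0,2], [0,1,2], [0,1], [1,2], [0,1,2]],
     [[0], [1], [2], [0,1], [0,2], [0,1,2], [0,1], [1,2], [0,1,2]],
     [[0], [0,1], [0,1,2], [0], [0,2], [0,1,2], [0,1], [0,2], [0,1,2]],
     [[0], [0,1], [0,2], [0], [0,1], [0,1,2], [0,2], [1,2], [0,1,2]]]"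

section \<open>Verification of the concrete codes by evaluation\<close>

lemma cis_check_cols1: "cis_check 1 3 [[0], [0], [0]]"
  by code_simp

lemma cis_check_cols2: "cis_check 2 4 [[0], [1], [0], [0,1], [1], [0,1]]"
  by code_simp

lemma cis_check_cols3: "\<forall>cs\<in>set cols3. cis_check 3 4 cs"
  by code_simp

lemma cis_check_cols4: "cis_check 4 6 cols4"
  by code_simp

lemma cis_check_cols5: "cis_check 5 7 cols5"
  by code_simp

lemma mult_cols4:
  assumes "p \<subseteq> {..<4}"
  shows "length (filter (\<lambda>c. set c = p) cols4) = of_bool (p \<inter> {0, 1} \<noteq> {})"
proof -
  have *: "\<forall>T\<in>set (subseqs [0..<4]). length (filter (\<lambda>c. set c = set T) cols4) = (if 0 \<in> set T \<or> 1 \<in> set T then 1 else 0)"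
    by code_simp
  obtain T where "T \<in> set (subseqs [0..<4])" "p = set T" using assms subset_lessThan_iff_subseqs[of p 4] by blast
  then show ?thesis using bspec[OF *] by simp
qed

lemma mult_cols5:
  assumes "p \<subseteq> {..<5}"
  shows "length (filter (\<lambda>c. set c = p) cols5) = of_bool (4 \<in> p \<and> p \<noteq> {4})"
proof -
  have *: "\<forall>T\<in>set (subseqs [0..<5]). length (filter (\<lambda>c. set c = set T) cols5) = (if 4 \<in> set T \<and> set T \<noteq> {4} then 1 else 0)"
    by code_simp
  obtain T where "T \<in> set (subseqs [0..<5])" "p = set T" using assms subset_lessThan_iff_subseqs[of p 5] by blast
  then show ?thesis using bspec[OF *] by simp
qed

section \<open>The eight optimal codes of length 9\<close>

text \<open>Two of the eight codes have the same weight distribution; the union of the words of weight 4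
  separates them.\<close>

definition invariant :: "nat set set \<Rightarrow> nat \<times> nat \<times> nat" where
  "invariant C = (card {c \<in> C. card c = 4}, card {c \<in> C. card c = 5}, card (\<Union>{c \<in> C. card c = 4}))"

text \<open>A permutation of the coordinates preserves weights, is injective on words and commutes
  with unions.\<close>

lemma invariant_code_equiv:
  assumes "code_equiv n C D" "\<And>c. c \<in> C \<Longrightarrow> c \<subseteq> {..<n}"
  shows "invariant C = invariant D"
proof -
  obtain \<sigma> where \<sigma>: "bij_betw \<sigma> {..<n} {..<n}" "D = (\<lambda>c. \<sigma> ` c) ` C"
    using assms(1) unfolding code_equiv_def by blast
  have inj: "inj_on \<sigma> {..<n}" using \<sigma>(1) by (rule bij_betw_imp_inj_on)
  have card_eq: "card (\<sigma> ` A) = card A" if "A \<subseteq> {..<n}" for A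
    by (rule card_image[OF inj_on_subset[OF inj that]])
  have inj': "inj_on ((`) \<sigma>) C"
    using inj assms(2) by (intro inj_onI) (metis inj_on_image_eq_iff)
  have D: "{d \<in> D. card d = m} = (`) \<sigma> ` {c \<in> C. card c = m}" for m
    using \<sigma>(2) card_eq assms(2) by auto
  have "card {d \<in> D. card d = m} = card {c \<in> C. card c = m}" for m
    unfolding D by (rule card_image) (rule inj_on_subset[OF inj'], auto)
  moreover have "\<Union>{d \<in> D. card d = 4} = \<sigma> ` \<Union>{c \<in> C. card c = 4}" unfolding D by auto
  moreover have "card (\<sigma> ` \<Union>{c \<in> C. card c = 4}) = card (\<Union>{c \<in> C. card c = 4})"
    using assms(2) by (intro card_eq) auto
  ultimately show ?thesis by (simp add: invariant_def)
qed

definition invariant_of :: "nat list list \<Rightarrow> nat \<times> nat \<times> nat" where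
  "invariant_of cs = (let ws = map (word cs) (subseqs [0..<3]) in
     (length (filter (\<lambda>v. length v = 4) ws), length (filter (\<lambda>v. length v = 5) ws),
      length (remdups (concat (filter (\<lambda>v. length v = 4) ws)))))"

text \<open>Independent rows give different words for different coefficient sets, so counting list
  entries counts words without repetition.\<close>

lemma invariant_code_of:
  assumes "cis_check 3 d cs"
  shows "invariant (code_of 3 cs) = invariant_of cs"
proof -
  define ws where "ws = map (word cs) (subseqs [0..<3])"
  have ws_set: "map set ws = map (row_comb (matrix_of cs)) (map set (subseqs [0..<3]))"
    using row_comb_matrix_of by (auto simp: ws_def)
  have pow: "set (map set (subseqs [0..<3])) = Pow {..<3::nat}"
    using subseqs_powset[of "[0..<3]"] by (simp add: atLeast0LessThan)
  have code: "code_of 3 cs = set (map set ws)"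
    unfolding ws_set code_of_def pow[symmetric] set_map image_image ..
  have "inj_on (row_comb (matrix_of cs)) (Pow {..<3})"
    by (rule independent_inj_on[OF generator_matrix_independent[OF cis_check_generator_matrix[OF assms]]])
  then have dist: "distinct (map set ws)"
    unfolding ws_set distinct_map[of "row_comb (matrix_of cs)"] pow by (simp add: distinct_set_subseqs)
  have card_word: "card (set v) = length v" if "v \<in> set ws" for v
    using that card_set_word by (auto simp: ws_def)
  have sub: "{c \<in> code_of 3 cs. card c = m} = set (map set (filter (\<lambda>v. length v = m) ws))" for m
    using card_word by (auto simp: code)
  have "card {c \<in> code_of 3 cs. card c = m} = length (filter (\<lambda>v. length v = m) ws)" for m
  proof -
    have "distinct (map set (filter (\<lambda>v. length v = m) ws))"
      using dist by (auto simp: distinct_map intro: inj_on_subset)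
    then show ?thesis unfolding sub by (metis distinct_card length_map)
  qed
  moreover have "\<Union>{c \<in> code_of 3 cs. card c = 4} = set (concat (filter (\<lambda>v. length v = 4) ws))"
    unfolding sub by auto
  ultimately show ?thesis
    by (simp add: invariant_def invariant_of_def ws_def[symmetric] Let_def length_remdups_card_conv del: set_concat)
qed

lemma cols3_inequivalent:
  "inj_on (\<lambda>cs. invariant (code_of 3 cs)) (set cols3)"
proof -
  have "distinct (map invariant_of cols3)" by code_simp
  then have "inj_on invariant_of (set cols3)" by (simp add: distinct_map)
  moreover have "invariant (code_of 3 cs) = invariant_of cs" if "cs \<in> set cols3" for cs
    using cis_check_cols3 invariant_code_of that by blast
  ultimately show ?thesis by (simp add: inj_on_def)
qed

text \<open>Each vector avoids the span of its predecessors; these spans are \<open>{{}}\<close>,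
  \<open>{{}, A}\<close> and \<open>{{}, A, B, sym_diff A B}\<close>.\<close>

lemma independent_three:
  assumes "A \<noteq> {}" "B \<noteq> {}" "A \<noteq> B" "E \<noteq> {}" "E \<noteq> A" "E \<noteq> B" "E \<noteq> sym_diff A B"
  shows "independent 3 ((\<lambda>_. {})(0 := A, 1 := B, 2 := E))"
proof -
  let ?P1 = "(\<lambda>_. {})(0 := A)" and ?P2 = "(\<lambda>_. {})(0 := A, 1 := B)"
  have "independent 0 (\<lambda>_. {})" by (simp add: independent_def)
  then have P1: "independent (Suc 0) ?P1"
    using assms(1) by (intro independent_upd) simp_all
  have "row_comb ?P1 ` Pow {..<Suc 0} = {{}, A}"
    by (auto simp: lessThan_Suc Pow_insert)
  then have P2: "independent (Suc 1) ?P2"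
    using assms(2,3) P1 by (intro independent_upd) simp_all
  have "row_comb ?P2 {1, 0} = sym_diff B A"
    by (subst row_comb_insert) simp_all
  then have "row_comb ?P2 ` Pow {..<Suc 1} = {{}, A, B, sym_diff B A}"
    by (auto simp: lessThan_Suc Pow_insert)
  moreover have "E \<noteq> sym_diff B A" using assms(7) by (simp add: Un_commute)
  ultimately have "E \<notin> row_comb ?P2 ` Pow {..<Suc 1}" using assms(4-6) by simp
  then have "independent (Suc (Suc 1)) (?P2(Suc 1 := E))" by (rule independent_upd[OF P2])
  then show ?thesis by (simp add: numeral_eq_Suc)
qed

lemma sum_Pow_3:
  fixes f :: "nat set \<Rightarrow> nat"
  shows "sum f (Pow {..<3}) = f {} + f {0} + f {1} + f {0, 1} + f {2} + f {0, 2} + f {1, 2} + f {0, 1, 2}"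
proof -
  have "Pow {..<3::nat} = set (map set (subseqs [0..<3]))"
    using subseqs_powset[of "[0..<3]"] by (simp add: atLeast0LessThan)
  then have "sum f (Pow {..<3}) = sum_list (map f (map set (subseqs [0..<3])))"
    using sum.distinct_set_conv_list[OF distinct_set_subseqs[of "[0..<3]"]] by simp
  then show ?thesis by (simp add: upt_rec insert_commute add_ac numeral_2_eq_2)
qed

lemma weights_3:
  assumes "CIS 3 3 D" "generator_matrix 9 3 G D"
  defines "m \<equiv> mult 9 3 G"
  shows "m {0} + m {1} + m {0, 1} + m {2} + m {0, 2} + m {1, 2} + m {0, 1, 2} = 9"
    and "card (row_comb G {0}) = m {0} + m {0, 1} + m {0, 2} + m {0, 1, 2}"
    and "card (row_comb G {1}) = m {1} + m {0, 1} + m {1, 2} + m {0, 1, 2}"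
    and "card (row_comb G {0, 1}) = m {0} + m {1} + m {0, 2} + m {1, 2}"
    and "card (row_comb G {2}) = m {2} + m {0, 2} + m {1, 2} + m {0, 1, 2}"
    and "card (row_comb G {0, 2}) = m {0} + m {0, 1} + m {2} + m {1, 2}"
    and "card (row_comb G {1, 2}) = m {1} + m {0, 1} + m {2} + m {0, 2}"
    and "card (row_comb G {0, 1, 2}) = m {0} + m {1} + m {2} + m {0, 1, 2}"
proof -
  have "m {} = 0" using CIS_mult_empty[OF assms(1), of G] assms(2) by (simp add: m_def)
  then show "m {0} + m {1} + m {0, 1} + m {2} + m {0, 2} + m {1, 2} + m {0, 1, 2} = 9"
    using sum_mult[of 9 3 G] by (simp add: sum_Pow_3 m_def)
qed (subst card_word_eq_mult[OF assms(2)]; simp add: sum_Pow_3 m_def)+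

text \<open>Averaging alone would still allow distance 5, because 7 * 5 \<le> 4 * 9.\<close>

lemma CIS_9_3_min_dist_le:
  assumes "CIS 3 3 D"
  shows "min_dist D \<le> 4"
proof (rule ccontr)
  assume d: "\<not> min_dist D \<le> 4"
  obtain G where G: "generator_matrix 9 3 G D" using CIS_generator_matrix[OF assms] by auto
  note W = weights_3[OF assms G]
  have ge: "5 \<le> card (row_comb G S)" if "S \<subseteq> {..<3}" "S \<noteq> {}" for S
    using min_dist_le[OF G that] d by linarith
  have ge': "5 \<le> card (row_comb G {0})" "5 \<le> card (row_comb G {1})" "5 \<le> card (row_comb G {0, 1})"
    "5 \<le> card (row_comb G {2})" "5 \<le> card (row_comb G {0, 2})" "5 \<le> card (row_comb G {1, 2})"
    "5 \<le> card (row_comb G {0, 1, 2})"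
    by (rule ge; simp)+
  note facts = W(1) ge'[unfolded W(2-)]
  \<comment> \<open>The three nonzero words vanishing on a column of multiplicity m have total
    weight 2 * (9 - m), which would be at least 15; so m \<le> 1, and seven columns cannot fill
    length 9.\<close>
  have "mult 9 3 G {0} \<le> 1" "mult 9 3 G {1} \<le> 1" "mult 9 3 G {0, 1} \<le> 1" "mult 9 3 G {2} \<le> 1"
    "mult 9 3 G {0, 2} \<le> 1" "mult 9 3 G {1, 2} \<le> 1" "mult 9 3 G {0, 1, 2} \<le> 1"
    using facts by linarith+
  then show False using W(1) by linarith
qed

text \<open>Multiplicities of the columns \<open>{0}\<close>, \<open>{1}\<close>,
  \<open>{0,1}\<close>, \<open>{2}\<close>, \<open>{0,2}\<close>, \<open>{1,2}\<close>,
  \<open>{0,1,2}\<close>, in this order. They are integers so that the last one can be computed from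
  the others by a subtraction that does not truncate.\<close>

definition profiles :: "int list list" where
  "profiles = [[2,0,2,0,2,0,3],[1,0,2,0,2,1,3],[2,0,2,0,2,1,2],[1,1,1,0,2,2,2],[1,1,1,1,1,1,3],[1,1,2,0,1,1,3],[1,1,2,0,2,1,2],[1,1,2,1,1,1,2]]"

lemma profiles_cols3:
  "\<forall>ms\<in>set profiles. \<exists>cs\<in>set cols3.
     map (\<lambda>T. int (length (filter (\<lambda>c. set c = set T) cs))) [[0], [1], [0,1], [2], [0,2], [1,2], [0,1,2]] = ms"
  by code_simp

text \<open>The constraints are the minimum distance, and the consequences of the choice of a basis
  with lexicographically maximal \<open>(w1, w2, w3, w4)\<close>.\<close>

lemma profile_enumeration:
  "\<forall>n1\<in>set [0,1,2,3]. \<forall>n2\<in>set [0,1,2,3]. \<forall>n3\<in>set [0,1,2,3]. \<forall>n4\<in>set [0,1,2,3]. \<forall>n5\<in>set [0,1,2,3]. \<forall>n6\<in>set [0,1,2,3].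
     let n7 = 9 - (n1 + n2 + n3 + n4 + n5 + n6) :: int in 0 \<le> n7 \<longrightarrow> n7 \<le> 3 \<longrightarrow>
      (let w1 = n1 + n3 + n5 + n7; w2 = n2 + n3 + n6 + n7; w3 = n1 + n2 + n5 + n6;
           w4 = n4 + n5 + n6 + n7; w5 = n1 + n3 + n4 + n6; w6 = n2 + n3 + n4 + n5;
           w7 = n1 + n2 + n4 + n7 in
       4 \<le> w3 \<longrightarrow> w3 \<le> w2 \<longrightarrow> 4 \<le> w5 \<longrightarrow> w5 \<le> w4 \<longrightarrow> 4 \<le> w6 \<longrightarrow> w6 \<le> w4 \<longrightarrow> 4 \<le> w7 \<longrightarrow> w7 \<le> w4 \<longrightarrow>
       w4 \<le> w2 \<longrightarrow> w2 \<le> w1 \<longrightarrow> (w1 = w2 \<longrightarrow> w4 = w2 \<longrightarrow> w6 \<le> w3) \<longrightarrow> (w4 = w2 \<longrightarrow> w5 \<le> w3) \<longrightarrow>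
       [n1, n2, n3, n4, n5, n6, n7] \<in> set profiles)"
  by code_simp

text \<open>Weights up to 9 are decimal digits, so comparing the numbers is comparing the digits
  lexicographically.\<close>

lemma lex_digits_le:
  fixes a b c d :: nat
  assumes "1000 * a + 100 * b + 10 * c + d \<le> 1000 * a' + 100 * b' + 10 * c' + d'"
    and "b' \<le> 9" "c' \<le> 9" "d' \<le> 9"
  shows "a \<le> a'" "a = a' \<Longrightarrow> b \<le> b'" "a = a' \<Longrightarrow> b = b' \<Longrightarrow> c \<le> c'"
    "a = a' \<Longrightarrow> b = b' \<Longrightarrow> c = c' \<Longrightarrow> d \<le> d'"
  using assms by linarith+

lemma CIS_9_3_4_classification:
  assumes D: "CIS 3 3 D" "min_dist D = 4"
  shows "\<exists>cs\<in>set cols3. code_equiv 9 (code_of 3 cs) D"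
proof -
  \<comment> \<open>The weights of row 0, row 1, their sum and row 2, packed as decimal digits;
    being bounded, this number is maximal for some basis.\<close>
  define f where "f G = 1000 * card (G 0) + 100 * card (G 1) + 10 * card (row_comb G {0, 1}) + card (G 2)"
    for G :: "nat \<Rightarrow> nat set"
  have le9: "card (row_comb G S) \<le> 9" if "generator_matrix 9 3 G D" "S \<subseteq> {..<3}" for G S
    using card_mono[OF _ generator_matrix_word_subset[OF that]] by simp
  have "f G < 10000" if "generator_matrix 9 3 G D" for G
    using le9[OF that, of "{0}"] le9[OF that, of "{1}"] le9[OF that, of "{0, 1}"] le9[OF that, of "{2}"]
    by (simp add: f_def)
  moreover obtain G0 where "generator_matrix 9 3 G0 D" using CIS_generator_matrix[OF D(1)] by auto
  ultimately obtain G where G: "generator_matrix 9 3 G D"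
    and max: "\<And>H. generator_matrix 9 3 H D \<Longrightarrow> f H \<le> f G"
    using ex_has_greatest_nat[of "\<lambda>H. generator_matrix 9 3 H D" G0 f 10000] by blast
  define w where "w S = card (row_comb G S)" for S
  note W = weights_3[OF D(1) G, folded w_def]
  have digits: "w S \<le> 9" if "S \<subseteq> {..<3}" for S using le9[OF G that] by (simp add: w_def)
  \<comment> \<open>Any independent coefficient sets \<open>A\<close>, \<open>B\<close>,
    \<open>E\<close> give a competing basis, and \<open>F\<close> is the coefficient set of the sum
    of its first two rows.\<close>
  have lex: "1000 * w A + 100 * w B + 10 * w F + w E \<le> 1000 * w {0} + 100 * w {1} + 10 * w {0, 1} + w {2}"
    if *: "A \<subseteq> {..<3}" "B \<subseteq> {..<3}" "E \<subseteq> {..<3}"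
      "A \<noteq> {}" "B \<noteq> {}" "A \<noteq> B" "E \<noteq> {}" "E \<noteq> A" "E \<noteq> B" "E \<noteq> F" "F = sym_diff A B" for A B E F
  proof -
    define P :: "nat \<Rightarrow> nat set" where "P = (\<lambda>_. {})(0 := A, 1 := B, 2 := E)"
    have fin: "finite A" "finite B" using *(1,2) by (auto intro: finite_subset)
    have "generator_matrix 9 3 (\<lambda>i. row_comb G (P i)) D"
    proof (rule generator_matrix_change_basis[OF G])
      show "independent 3 P" unfolding P_def using *(4-) by (intro independent_three) simp_all
    qed (use *(1-3) in \<open>auto simp: P_def\<close>)
    moreover have "row_comb (\<lambda>i. row_comb G (P i)) {0, 1} = row_comb G (sym_diff A B)"
      using fin by (subst row_comb_insert) (auto simp: P_def row_comb_sym_diff)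
    ultimately show ?thesis using max *(11) by (fastforce simp: f_def w_def P_def)
  qed
  note lex_le = lex_digits_le[OF lex digits digits digits]
  \<comment> \<open>Each instance lists \<open>A\<close>, \<open>B\<close>, \<open>E\<close>,
    \<open>F\<close> of a competing basis whose digits before the compared one agree with those of
    the maximal basis.\<close>
  have w21: "w {1} \<le> w {0}" by (rule lex_le(1)[of "{1}" "{0}" "{2}" "{0, 1}"]) (rule refl | simp; fail | code_simp)+
  have w32: "w {0, 1} \<le> w {1}" by (rule lex_le(2)[of "{0}" "{0, 1}" "{2}" "{1}"]) (rule refl | simp; fail | code_simp)+
  have w42: "w {2} \<le> w {1}" by (rule lex_le(2)[of "{0}" "{2}" "{1}" "{0, 2}"]) (rule refl | simp; fail | code_simp)+
  have w54: "w {0, 2} \<le> w {2}" by (rule lex_le(4)[of "{0}" "{1}" "{0, 2}" "{0, 1}"]) (rule refl | simp; fail | code_simp)+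
  have w64: "w {1, 2} \<le> w {2}" by (rule lex_le(4)[of "{0}" "{1}" "{1, 2}" "{0, 1}"]) (rule refl | simp; fail | code_simp)+
  have w74: "w {0, 1, 2} \<le> w {2}" by (rule lex_le(4)[of "{0}" "{1}" "{0, 1, 2}" "{0, 1}"]) (rule refl | simp; fail | code_simp)+
  \<comment> \<open>Ties among the row weights allow rows to be exchanged without changing the
    leading digits, which bounds the third digit as well.\<close>
  have t1: "w {1, 2} \<le> w {0, 1}" if "w {0} = w {1}" "w {2} = w {1}"
    by (rule lex_le(3)[of "{1}" "{2}" "{0}" "{1, 2}"]) (rule refl that | simp add: that; fail | code_simp)+
  have t2: "w {0, 2} \<le> w {0, 1}" if "w {2} = w {1}"
    by (rule lex_le(3)[of "{0}" "{2}" "{1}" "{0, 2}"]) (rule refl that | simp add: that; fail | code_simp)+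
  have w4: "4 \<le> w S" if "S \<subseteq> {..<3}" "S \<noteq> {}" for S
    using min_dist_le[OF G that] D(2) by (simp add: w_def)
  have w4': "4 \<le> w {0, 1}" "4 \<le> w {0, 2}" "4 \<le> w {1, 2}" "4 \<le> w {0, 1, 2}"
    by (rule w4; simp)+
  define n where "n p = int (mult 9 3 G p)" for p
  have n_sum: "n {0} + n {1} + n {0, 1} + n {2} + n {0, 2} + n {1, 2} + n {0, 1, 2} = 9"
    unfolding n_def using W(1) by linarith
  have W_int: "int (w {0}) = n {0} + n {0, 1} + n {0, 2} + n {0, 1, 2}"
    "int (w {1}) = n {1} + n {0, 1} + n {1, 2} + n {0, 1, 2}"
    "int (w {0, 1}) = n {0} + n {1} + n {0, 2} + n {1, 2}"
    "int (w {2}) = n {2} + n {0, 2} + n {1, 2} + n {0, 1, 2}"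
    "int (w {0, 2}) = n {0} + n {0, 1} + n {2} + n {1, 2}"
    "int (w {1, 2}) = n {1} + n {0, 1} + n {2} + n {0, 2}"
    "int (w {0, 1, 2}) = n {0} + n {1} + n {2} + n {0, 1, 2}"
    by (simp_all only: n_def W(2-) of_nat_add)
  have range: "0 \<le> n p" "n p \<le> 3" for p
    using CIS_mult_le[OF D(1), of G p] G by (simp_all add: n_def)
  have mem: "n p \<in> set [0,1,2,3]" for p using range[of p] by simp linarith
  have n7: "9 - (n {0} + n {1} + n {0, 1} + n {2} + n {0, 2} + n {1, 2}) = n {0, 1, 2}"
    using n_sum by linarith
  have "[n {0}, n {1}, n {0, 1}, n {2}, n {0, 2}, n {1, 2}, n {0, 1, 2}] \<in> set profiles"
    using profile_enumeration[unfolded Let_def, rule_format,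
        OF mem[of "{0}"] mem[of "{1}"] mem[of "{0, 1}"] mem[of "{2}"] mem[of "{0, 2}"] mem[of "{1, 2}"],
        unfolded n7, OF range, folded W_int, unfolded of_nat_le_iff of_nat_eq_iff]
      w4' w21 w32 w42 w54 w64 w74 t1 t2 by simp
  then obtain cs where cs: "cs \<in> set cols3"
    "map (\<lambda>T. int (length (filter (\<lambda>c. set c = set T) cs))) [[0], [1], [0,1], [2], [0,2], [1,2], [0,1,2]] =
      [n {0}, n {1}, n {0, 1}, n {2}, n {0, 2}, n {1, 2}, n {0, 1, 2}]"
    using profiles_cols3 by blast
  have check: "cis_check 3 4 cs" using cis_check_cols3 cs(1) by blast
  have "code_equiv (3 * 3) (code_of 3 cs) D"
  proof (rule code_equiv_code_of[OF check])
    show "generator_matrix (3 * 3) 3 G D" using G by simp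
    fix p :: "nat set" assume p: "p \<subseteq> {..<3}"
    have "filter (\<lambda>c. set c = {}) cs = []"
    proof -
      have "\<forall>cs\<in>set cols3. filter (\<lambda>c. c = []) cs = []" by code_simp
      then show ?thesis using cs(1) by simp
    qed
    moreover have "mult 9 3 G {} = 0" using CIS_mult_empty[OF D(1), of G] G by simp
    moreover have "p = {} \<or> p = {0} \<or> p = {1} \<or> p = {0, 1} \<or> p = {2} \<or> p = {0, 2} \<or> p = {1, 2} \<or> p = {0, 1, 2}"
    proof -
      have "p \<in> set (map set (subseqs [0..<3]))"
        using p subseqs_powset[of "[0..<3]"] by (simp add: atLeast0LessThan)
      then show ?thesis by (simp add: upt_rec numeral_2_eq_2) blast
    qed
    ultimately show "mult (3 * 3) 3 G p = length (filter (\<lambda>c. set c = p) cs)"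
      using cs(2) by (elim disjE) (simp_all add: n_def)
  qed
  then show ?thesis using cs(1) by auto
qed

section \<open>Optimal codes of dimension 1 and 2\<close>

text \<open>Zero columns are excluded, and in dimension 1 only one other column exists.\<close>

lemma CIS_3_1_3_normal_form:
  assumes D: "CIS 3 1 D"
  shows "\<exists>H. generator_matrix (3 * 1) 1 H D \<and>
    (\<forall>p\<subseteq>{..<1}. mult (3 * 1) 1 H p = length (filter (\<lambda>c. set c = p) [[0], [0], [0]]))"
proof -
  obtain G where G: "generator_matrix (3 * 1) 1 G D" using CIS_generator_matrix[OF D] by auto
  have P: "Pow {..<1::nat} = {{}, {0}}" by auto
  have m0: "mult (3 * 1) 1 G {} = 0" by (rule CIS_mult_empty[OF D G])
  have "(\<Sum>p\<in>{{}, {0}}. mult (3 * 1) 1 G p) = 3"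
    unfolding P[symmetric] sum_mult by simp
  then have m1: "mult (3 * 1) 1 G {0} = 3" using m0 by simp
  have "mult (3 * 1) 1 G p = length (filter (\<lambda>c. set c = p) [[0], [0], [0]])" if "p \<subseteq> {..<1}" for p
  proof -
    have "p = {} \<or> p = {0}" using that P by blast
    then show ?thesis using m0 m1 by (elim disjE) simp_all
  qed
  with G show ?thesis by blast
qed

text \<open>Each nonzero word vanishes on exactly one of the three nonzero columns; weight at least
  4 of 6 bounds each multiplicity by 2, and the length forces equality.\<close>

lemma CIS_6_2_4_normal_form:
  assumes D: "CIS 3 2 D" "min_dist D = 4"
  shows "\<exists>H. generator_matrix (3 * 2) 2 H D \<and>
    (\<forall>p\<subseteq>{..<2}. mult (3 * 2) 2 H p = length (filter (\<lambda>c. set c = p) [[0], [1], [0], [0,1], [1], [0,1]]))"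
proof -
  obtain G where G: "generator_matrix (3 * 2) 2 G D" using CIS_generator_matrix[OF D(1)] by auto
  have P: "Pow {..<2::nat} = set (map set (subseqs [0..<2]))"
    using subseqs_powset[of "[0..<2]"] by (simp add: atLeast0LessThan)
  have sum2: "sum f (Pow {..<2}) = f {} + f {0} + f {1} + f {0, 1}" for f :: "nat set \<Rightarrow> nat"
  proof -
    have "sum f (Pow {..<2}) = sum_list (map f (map set (subseqs [0..<2])))"
      using sum.distinct_set_conv_list[OF distinct_set_subseqs[of "[0..<2]"]] P by simp
    then show ?thesis by (simp add: upt_rec)
  qed
  have m0: "mult (3 * 2) 2 G {} = 0" by (rule CIS_mult_empty[OF D(1) G])
  have "mult (3 * 2) 2 G {} + mult (3 * 2) 2 G {0} + mult (3 * 2) 2 G {1} + mult (3 * 2) 2 G {0, 1} = 6"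
    using sum_mult[of "3 * 2" 2 G] by (simp only: sum2)
  moreover have "4 \<le> mult (3 * 2) 2 G {0} + mult (3 * 2) 2 G {0, 1}"
    using min_dist_le[OF G, of "{0}"] card_word_eq_mult[OF G, of "{0}"] D(2) by (simp add: sum2)
  moreover have "4 \<le> mult (3 * 2) 2 G {1} + mult (3 * 2) 2 G {0, 1}"
    using min_dist_le[OF G, of "{1}"] card_word_eq_mult[OF G, of "{1}"] D(2) by (simp add: sum2)
  moreover have "4 \<le> mult (3 * 2) 2 G {0} + mult (3 * 2) 2 G {1}"
    using min_dist_le[OF G, of "{0, 1}"] card_word_eq_mult[OF G, of "{0, 1}"] D(2) by (simp add: sum2)
  ultimately have m: "mult (3 * 2) 2 G {0} = 2" "mult (3 * 2) 2 G {1} = 2" "mult (3 * 2) 2 G {0, 1} = 2"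
    using m0 by linarith+
  have "mult (3 * 2) 2 G p = length (filter (\<lambda>c. set c = p) [[0], [1], [0], [0,1], [1], [0,1]])"
    if "p \<subseteq> {..<2}" for p
  proof -
    have "p \<in> set (map set (subseqs [0..<2]))" using that P by blast
    then have "p = {} \<or> p = {0} \<or> p = {1} \<or> p = {0, 1}" by (simp add: upt_rec) blast
    moreover have "length (filter (\<lambda>c. set c = {}) [[0], [1], [0], [0,1], [1], [0,1::nat]]) = 0"
      "length (filter (\<lambda>c. set c = {0}) [[0], [1], [0], [0,1], [1], [0,1::nat]]) = 2"
      "length (filter (\<lambda>c. set c = {1}) [[0], [1], [0], [0,1], [1], [0,1::nat]]) = 2"
      "length (filter (\<lambda>c. set c = {0, 1}) [[0], [1], [0], [0,1], [1], [0,1::nat]]) = 2"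
      by code_simp+
    ultimately show ?thesis using m0 m by (elim disjE) (simp_all only:)
  qed
  with G show ?thesis by blast
qed

section \<open>Uniqueness in dimensions 1, 2, 4, 5 and the eight classes in dimension 3\<close>

theorem theorem5:
  shows "(\<forall>k\<in>{1,2,4,5::nat}.
            \<exists>C. CIS 3 k C \<and>
                (\<forall>D. CIS 3 k D \<longrightarrow> min_dist D \<le> min_dist C) \<and>
                (\<forall>D. CIS 3 k D \<and> min_dist D = min_dist C \<longrightarrow> code_equiv (3 * k) C D))
       \<and> (\<forall>D. CIS 3 3 D \<longrightarrow> min_dist D \<le> 4)
       \<and> (\<exists>S. card S = 8 \<and>
              (\<forall>C\<in>S. CIS 3 3 C \<and> min_dist C = 4) \<and>
              (\<forall>C\<in>S. \<forall>D\<in>S. C \<noteq> D \<longrightarrow> \<not> code_equiv 9 C D) \<and>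
              (\<forall>D. CIS 3 3 D \<and> min_dist D = 4 \<longrightarrow> (\<exists>C\<in>S. code_equiv 9 C D)))"
proof -
  let ?unique = "\<lambda>k. \<exists>C. CIS 3 k C \<and> (\<forall>D. CIS 3 k D \<longrightarrow> min_dist D \<le> min_dist C) \<and>
    (\<forall>D. CIS 3 k D \<and> min_dist D = min_dist C \<longrightarrow> code_equiv (3 * k) C D)"
  \<comment> \<open>For the four dimensions the averaging bound reads d \<le> 3, 3 d \<le> 12, 15 d
    \<le> 96 and 31 d \<le> 240.\<close>
  have "?unique 1"
    using CIS_3_1_3_normal_form
    by (intro unique_optimal_code[OF cis_check_cols1]) (auto dest: CIS_Plotkin_bound)
  moreover have "?unique 2"
  proof (rule unique_optimal_code[OF cis_check_cols2])
    show "min_dist D \<le> 4" if "CIS 3 2 D" for D using CIS_Plotkin_bound[OF that] by simp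
  qed (rule CIS_6_2_4_normal_form)
  moreover have "?unique 4"
  proof (rule unique_optimal_code[OF cis_check_cols4])
    show "min_dist D \<le> 6" if "CIS 3 4 D" for D using CIS_Plotkin_bound[OF that] by simp
    show "\<exists>H. generator_matrix (3 * 4) 4 H D \<and>
        (\<forall>p\<subseteq>{..<4}. mult (3 * 4) 4 H p = length (filter (\<lambda>c. set c = p) cols4))"
      if "CIS 3 4 D" "min_dist D = 6" for D
      using CIS_12_4_6_normal_form[OF that] by (simp add: mult_cols4)
  qed
  moreover have "?unique 5"
  proof (rule unique_optimal_code[OF cis_check_cols5])
    show "min_dist D \<le> 7" if "CIS 3 5 D" for D using CIS_Plotkin_bound[OF that] by simp
    show "\<exists>H. generator_matrix (3 * 5) 5 H D \<and>
        (\<forall>p\<subseteq>{..<5}. mult (3 * 5) 5 H p = length (filter (\<lambda>c. set c = p) cols5))"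
      if "CIS 3 5 D" "min_dist D = 7" for D
      using CIS_15_5_7_normal_form[OF that] by (simp add: mult_cols5)
  qed
  ultimately have "\<forall>k\<in>{1,2,4,5::nat}. ?unique k" by blast
  moreover have "\<exists>S. card S = 8 \<and> (\<forall>C\<in>S. CIS 3 3 C \<and> min_dist C = 4) \<and>
      (\<forall>C\<in>S. \<forall>D\<in>S. C \<noteq> D \<longrightarrow> \<not> code_equiv 9 C D) \<and>
      (\<forall>D. CIS 3 3 D \<and> min_dist D = 4 \<longrightarrow> (\<exists>C\<in>S. code_equiv 9 C D))"
  proof (intro exI[of _ "code_of 3 ` set cols3"] conjI ballI allI impI)
    \<comment> \<open>Different invariants make the eight codes different as sets, and below also
      inequivalent.\<close>
    have "inj_on (code_of 3) (set cols3)"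
      using cols3_inequivalent unfolding inj_on_def by metis
    moreover have "distinct cols3" "length cols3 = 8" by code_simp+
    ultimately show "card (code_of 3 ` set cols3) = 8" by (metis card_image distinct_card)
  next
    fix C D assume "C \<in> code_of 3 ` set cols3" "D \<in> code_of 3 ` set cols3" "C \<noteq> D"
    then obtain a b where ab: "a \<in> set cols3" "b \<in> set cols3" "C = code_of 3 a" "D = code_of 3 b" "a \<noteq> b"
      by blast
    show "\<not> code_equiv 9 C D"
    proof
      assume eq: "code_equiv 9 C D"
      have "cis_check 3 4 a" using cis_check_cols3 ab(1) by blast
      then have G: "generator_matrix 9 3 (matrix_of a) C"
        using cis_check_generator_matrix[of 3 4 a] ab(3) by simp
      have "c \<subseteq> {..<9}" if "c \<in> C" for c
        using that generator_matrix_word_subset[OF G] unfolding generator_matrix_code[OF G] by blast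
      then have "invariant C = invariant D" using invariant_code_equiv[OF eq] by blast
      then show False using cols3_inequivalent ab by (simp add: inj_on_def)
    qed
  next
    fix C assume "C \<in> code_of 3 ` set cols3"
    then obtain a where a: "cis_check 3 4 a" "C = code_of 3 a" using cis_check_cols3 by blast
    show "CIS 3 3 C" unfolding a(2) by (rule cis_check_CIS[OF a(1)])
    show "min_dist C = 4" unfolding a(2) by (rule cis_check_min_dist[OF a(1)])
  next
    fix D assume "CIS 3 3 D \<and> min_dist D = 4"
    then show "\<exists>C\<in>code_of 3 ` set cols3. code_equiv 9 C D"
      using CIS_9_3_4_classification[of D] by blast
  qed
  ultimately show ?thesis using CIS_9_3_min_dist_le by blast
qed

end
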